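(* There exist absolute constants $C, c > 0$ such that the following holds. Let $n \ge 2$ and let $D = \mathrm{diag}(d_1, \ldots, d_n)$ be a fixed diagonal matrix with $d_i \in \mathbb{C}$. Assume that $$\max_{i} |d_i| \le K, \qquad \max_{i,j} |d_i^2 - d_j^2| \ge \delta$$ for some $K \ge 1$ and $\delta \in (0,1)$. Let $U$ be a random matrix uniformly distributed in the (real) orthogonal group $O(n)$. Then $$\mathbb{P}\{ s_{\min}(D+U) \le t \} \le t^{c}\, (Kn/\delta)^{C} \quad \text{for all } t > 0.$$
   Context: For an $n\times n$ complex matrix $A$, $s_{\min}(A)$ denotes its smallest singular value. "Uniformly distributed" means distributed according to the normalized Haar measure. The constants $C,c$ do not depend on $n, D, K, \delta, t$. *)

theory Defs
  imports
    "HOL-Probability.Probability"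
    "Jordan_Normal_Form.Schur_Decomposition"
begin

definition singular_values :: "complex mat \<Rightarrow> real set" where
  "singular_values A =
     {s. 0 \<le> s \<and> eigenvalue (mat_adjoint A * A) (complex_of_real (s\<^sup>2))}"

definition s_min :: "complex mat \<Rightarrow> real" where
  "s_min A = Min (singular_values A)"

(* orthogonal_mat of Jordan_Normal_Form only asks for pairwise orthogonal non-zero columns,
   not for orthonormal ones, so it is not the notion needed here. *)
definition orthogonal_group :: "nat \<Rightarrow> real mat set" where
  "orthogonal_group n = {Q \<in> carrier_mat n n. transpose_mat Q * Q = 1\<^sub>m n}"

(* The Borel sigma-algebra of O(n) as a subspace of R^(n x n): the type of matrices carries no
   topology, so it is pulled back along the entries. As a measure this is only a carrier for
   space and sets. *)
definition borel_orthogonal_group :: "nat \<Rightarrow> real mat measure" where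
  "borel_orthogonal_group n =
     vimage_algebra (orthogonal_group n)
       (\<lambda>Q. \<lambda>(i, j) \<in> {..<n} \<times> {..<n}. Q $$ (i, j))
       (Pi\<^sub>M ({..<n} \<times> {..<n}) (\<lambda>_. borel))"

(* O(n) is compact, so its normalized Haar measure is the unique left-invariant Borel probability
   measure; it is then right-invariant as well. *)
definition haar_orthogonal_group :: "nat \<Rightarrow> real mat measure \<Rightarrow> bool" where
  "haar_orthogonal_group n \<mu> \<longleftrightarrow>
     prob_space \<mu> \<and>
     sets \<mu> = sets (borel_orthogonal_group n) \<and>
     (\<forall>Q \<in> orthogonal_group n. distr \<mu> \<mu> (\<lambda>U. Q * U) = \<mu>)"

end

theory Submission
  imports Defs "HOL-Real_Asymp.Real_Asymp" "Jordan_Normal_Form.Spectral_Radius"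
begin

text \<open>
  Write \<open>A = D + U\<close>, \<open>B = A\<^sup>-\<^sup>1\<close>, \<open>G = U B\<close>, and let \<open>q\<close> be the quadratic form of \<open>2 G - 1\<close>. If \<open>H\<close> is the
  reflection along a real vector \<open>u\<close>, then \<open>H U\<close> has the same distribution as \<open>U\<close>, and the rank-one
  update formula gives \<open>(D + H U)\<^sup>-\<^sup>1 u = - (|u|\<^sup>2 / q u) B u\<close>. Since \<open>H U\<close> is independent of a random
  \<open>u\<close>, the inverse of \<open>D + H U\<close>, when it is large, is most likely also large along \<open>u\<close>; this event
  is studied for fixed \<open>U\<close> and random \<open>u\<close>, so that several simultaneous small singular values of \<open>A\<close>
  do no harm. Let \<open>\<tau>\<close> and \<open>S\<close> be the sizes of \<open>B\<close> and \<open>q\<close>. If \<open>\<tau> / S\<close> is well below \<open>T\<close>, then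
  the inverse exceeds \<open>T\<close> along \<open>u\<close> with small probability. Otherwise \<open>D + H U\<close> has an inverse of size about
  \<open>\<tau>\<^sup>2 / S\<close> for most \<open>u\<close>, which is much larger than \<open>T\<close> because \<open>S\<close> is bounded below: \<open>q\<close> takes the values
  \<open>1 - d\<^sub>i\<^sup>2\<close> at the columns of \<open>A\<close>, and these do not all vanish. Hence \<open>p T\<close>, the probability that \<open>B\<close> has size
  at least \<open>T\<close>, satisfies \<open>p T \<le> 12 T\<^bsup>-1/16\<^esup> + 6 p (T\<^bsup>5/4\<^esup>)\<close>. This is iterated until \<open>T\<close> is so large
  that a crude, dimension-dependent bound finishes the proof; such a bound holds after replacing \<open>D\<close> by
  \<open>D + \<lambda>\<close> for a suitable \<open>\<lambda> \<in> (0, t]\<close>, because \<open>det (D + \<lambda> + U)\<close> has only \<open>n\<close> roots in \<open>\<lambda>\<close>.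
\<close>

unbundle no vec_syntax
unbundle no inner_syntax

subsection \<open>Counting small values of linear and quadratic functions on a grid\<close>

text \<open>At two different integers the values differ by at least \<open>cmod a\<close>, so they
  cannot both be closer than \<open>cmod a / 2\<close> to zero.\<close>

lemma card_linear_small_le:
  fixes a b :: complex
  assumes "a \<noteq> 0"
  shows "card {x \<in> {1..m::nat}. cmod (of_nat x * a + b) < cmod a / 2} \<le> 1"
proof -
  have "x = y" if x: "cmod (of_nat x * a + b) < cmod a / 2" and y: "cmod (of_nat y * a + b) < cmod a / 2" for x y :: nat
  proof (rule ccontr)
    assume "x \<noteq> y"
    have "cmod ((of_nat x - of_nat y) * a) = cmod ((of_nat x * a + b) - (of_nat y * a + b))"
      by (simp add: algebra_simps)
    also have "\<dots> < cmod a"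
      using norm_triangle_ineq4[of "of_nat x * a + b" "of_nat y * a + b"] x y by linarith
    finally have "cmod (of_nat x - of_nat y) < 1"
      using assms by (simp add: norm_mult)
    moreover have "of_nat x - of_nat y = complex_of_real (real_of_int (int x - int y))" by simp
    ultimately have "\<bar>real_of_int (int x - int y)\<bar> < 1"
      by (metis norm_of_real)
    then show False using \<open>x \<noteq> y\<close> by linarith
  qed
  then have "is_singleton {x \<in> {1..m::nat}. cmod (of_nat x * a + b) < cmod a / 2}
      \<or> {x \<in> {1..m::nat}. cmod (of_nat x * a + b) < cmod a / 2} = {}"
    by (intro disjCI is_singletonI') blast+
  then show ?thesis by (elim disjE) (simp_all only: is_singleton_altdef card.empty le_refl zero_le)
qed

lemma card_nats_near_le:
  "card {x \<in> {1..m::nat}. cmod (of_nat x - z) \<le> 1} \<le> 3"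
proof -
  have "{x \<in> {1..m::nat}. cmod (of_nat x - z) \<le> 1} \<subseteq> nat ` {\<lceil>Re z\<rceil> - 1..\<lceil>Re z\<rceil> + 1}"
  proof
    fix x assume "x \<in> {x \<in> {1..m::nat}. cmod (of_nat x - z) \<le> 1}"
    then have "\<bar>real x - Re z\<bar> \<le> 1"
      using abs_Re_le_cmod[of "of_nat x - z"] by simp
    then have "int x \<in> {\<lceil>Re z\<rceil> - 1..\<lceil>Re z\<rceil> + 1}" by simp linarith
    then show "x \<in> nat ` {\<lceil>Re z\<rceil> - 1..\<lceil>Re z\<rceil> + 1}" by (metis image_eqI nat_int)
  qed
  then have "card {x \<in> {1..m::nat}. cmod (of_nat x - z) \<le> 1} \<le> card (nat ` {\<lceil>Re z\<rceil> - 1..\<lceil>Re z\<rceil> + 1})"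
    by (intro card_mono) auto
  also have "\<dots> \<le> card {\<lceil>Re z\<rceil> - 1..\<lceil>Re z\<rceil> + 1}" by (rule card_image_le) auto
  finally show ?thesis by simp
qed

lemma complex_quadratic_factor:
  fixes a b c :: complex
  assumes "a \<noteq> 0"
  obtains r1 r2 where "\<And>x. x\<^sup>2 * a + x * b + c = a * (x - r1) * (x - r2)"
proof -
  define w where "w = csqrt (b\<^sup>2 - 4 * a * c)"
  have w: "w\<^sup>2 = b\<^sup>2 - 4 * a * c" by (simp add: w_def)
  show ?thesis
  proof (rule that[of "(- b + w) / (2 * a)" "(- b - w) / (2 * a)"])
    fix x
    have "4 * a * (a * (x - (- b + w) / (2 * a)) * (x - (- b - w) / (2 * a)))
        = (2 * a * x + b - w) * (2 * a * x + b + w)"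
      using assms by (simp add: field_simps)
    also have "\<dots> = (2 * a * x + b)\<^sup>2 - w\<^sup>2" by (simp add: algebra_simps power2_eq_square)
    also have "\<dots> = 4 * a * (x\<^sup>2 * a + x * b + c)" unfolding w by (simp add: algebra_simps power2_eq_square)
    finally show "x\<^sup>2 * a + x * b + c = a * (x - (- b + w) / (2 * a)) * (x - (- b - w) / (2 * a))"
      using assms by (metis mult_cancel_left mult_eq_0_iff zero_neq_numeral)
  qed
qed

text \<open>After factoring as \<open>a * (x - r1) * (x - r2)\<close>, a small value forces
  \<open>x\<close> to lie within distance 1 of one of the two roots, and at most three integers are
  that close to a given point.\<close>

lemma card_quadratic_small_le:
  fixes a b c :: complex
  assumes "a \<noteq> 0"
  shows "card {x \<in> {1..m::nat}. cmod ((of_nat x)\<^sup>2 * a + of_nat x * b + c) \<le> cmod a} \<le> 6"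
proof -
  obtain r1 r2 where r: "\<And>x. x\<^sup>2 * a + x * b + c = a * (x - r1) * (x - r2)"
    using complex_quadratic_factor[OF assms] by metis
  let ?N = "\<lambda>z. {x \<in> {1..m::nat}. cmod (of_nat x - z) \<le> 1}"
  have "{x \<in> {1..m::nat}. cmod ((of_nat x)\<^sup>2 * a + of_nat x * b + c) \<le> cmod a} \<subseteq> ?N r1 \<union> ?N r2"
  proof
    fix x assume x: "x \<in> {x \<in> {1..m::nat}. cmod ((of_nat x)\<^sup>2 * a + of_nat x * b + c) \<le> cmod a}"
    then have "cmod a * (cmod (of_nat x - r1) * cmod (of_nat x - r2)) \<le> cmod a * 1"
      unfolding r by (simp add: norm_mult)
    then have "cmod (of_nat x - r1) * cmod (of_nat x - r2) \<le> 1"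
      using assms by (metis mult_le_cancel_left_pos zero_less_norm_iff)
    then have "\<not> (1 < cmod (of_nat x - r1) \<and> 1 < cmod (of_nat x - r2))"
      using less_1_mult[of "cmod (of_nat x - r1)" "cmod (of_nat x - r2)"] by linarith
    then show "x \<in> ?N r1 \<union> ?N r2" using x by auto
  qed
  then have "card {x \<in> {1..m::nat}. cmod ((of_nat x)\<^sup>2 * a + of_nat x * b + c) \<le> cmod a} \<le> card (?N r1 \<union> ?N r2)"
    by (intro card_mono) auto
  also have "\<dots> \<le> card (?N r1) + card (?N r2)" by (rule card_Un_le)
  also have "\<dots> \<le> 6" using card_nats_near_le[of m r1] card_nats_near_le[of m r2] by linarith
  finally show ?thesis .
qed

text \<open>Fubini on a finite product: freeze all coordinates except \<open>f\<close> and count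
  along each line. The inequality is multiplied out, so that proportions of the grid need no
  division.\<close>

lemma card_PiE_slices_le:
  fixes m k :: nat
  assumes "finite F" "f \<in> F" and B: "B \<subseteq> F \<rightarrow>\<^sub>E {1..m}"
    and slice: "\<And>s. s \<in> F \<rightarrow>\<^sub>E {1..m} \<Longrightarrow> card {x \<in> {1..m}. s(f := x) \<in> B} \<le> k"
  shows "m * card B \<le> k * card (F \<rightarrow>\<^sub>E {1..m})"
proof (cases "m = 0")
  case True
  then show ?thesis by simp
next
  case False
  let ?F' = "F - {f}"
  let ?P = "?F' \<rightarrow>\<^sub>E {1..m}"
  have F: "insert f ?F' = F" using assms by auto
  have fin: "finite ?P" using assms by (intro finite_PiE) auto
  have cardF: "card (F \<rightarrow>\<^sub>E {1..m}) = m * card ?P"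
  proof -
    have "card (F \<rightarrow>\<^sub>E {1..m}) = m ^ card F" using assms by (simp add: card_PiE)
    moreover have "card ?P = m ^ card ?F'" using assms by (simp add: card_PiE)
    moreover have "card F = Suc (card ?F')" using assms by (metis card_Suc_Diff1)
    ultimately show ?thesis by simp
  qed
  have "B \<subseteq> (\<lambda>(s, x). s(f := x)) ` (SIGMA s:?P. {x \<in> {1..m}. s(f := x) \<in> B})"
  proof
    fix s assume s: "s \<in> B"
    then have sF: "s \<in> F \<rightarrow>\<^sub>E {1..m}" using B by auto
    have e: "s = (s(f := undefined))(f := s f)" by simp
    have "s(f := undefined) \<in> ?P" using sF by (auto simp: PiE_def Pi_def extensional_def)
    moreover have "s f \<in> {1..m}" using sF assms by auto
    ultimately have "(s(f := undefined), s f) \<in> (SIGMA s:?P. {x \<in> {1..m}. s(f := x) \<in> B})"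
      using s by auto
    then show "s \<in> (\<lambda>(s, x). s(f := x)) ` (SIGMA s:?P. {x \<in> {1..m}. s(f := x) \<in> B})"
      by (intro image_eqI[of _ _ "(s(f := undefined), s f)"]) auto
  qed
  moreover have fs: "finite (SIGMA s:?P. {x \<in> {1..m}. s(f := x) \<in> B})" using fin by auto
  ultimately have "card B \<le> card (SIGMA s:?P. {x \<in> {1..m}. s(f := x) \<in> B})"
    using surj_card_le by blast
  also have "\<dots> = (\<Sum>s\<in>?P. card {x \<in> {1..m}. s(f := x) \<in> B})"
    using fin by (simp add: card_SigmaI)
  also have "\<dots> \<le> (\<Sum>s\<in>?P. k)"
  proof (rule sum_mono)
    fix s assume s: "s \<in> ?P"
    \<comment> \<open>The value 1 is a placeholder: \<open>slice\<close> wants a point of the full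
      product, and the coordinate \<open>f\<close> is overwritten anyway.\<close>
    have "s(f := 1) \<in> F \<rightarrow>\<^sub>E {1..m}" using s False assms(2)
      by (auto simp: PiE_def Pi_def extensional_def)
    from slice[OF this] show "card {x \<in> {1..m}. s(f := x) \<in> B} \<le> k" by simp
  qed
  also have "\<dots> = k * card ?P" by simp
  finally show ?thesis unfolding cardF by simp
qed

subsection \<open>Reflections and rank-one updates\<close>

lemma mult_mat_vec_index_sum:
  "A \<in> carrier_mat n m \<Longrightarrow> y \<in> carrier_vec m \<Longrightarrow> i < n \<Longrightarrow> (A *\<^sub>v y) $ i = (\<Sum>j<m. A $$ (i, j) * y $ j)"
  by (simp add: scalar_prod_def atLeast0LessThan)

text \<open>The Householder matrix \<open>1 - 2 u u^T / |u|^2\<close>. Dividing by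
  \<open>|u|^2\<close> allows integer vectors \<open>u\<close>; for \<open>u = 0\<close> division by
  zero makes it the identity.\<close>

definition reflection :: "nat \<Rightarrow> (nat \<Rightarrow> real) \<Rightarrow> real mat" where
  "reflection n u = mat n n (\<lambda>(i, j). (if i = j then 1 else 0) - 2 / (\<Sum>k<n. (u k)\<^sup>2) * u i * u j)"

lemma reflection_carrier [simp]: "reflection n u \<in> carrier_mat n n"
  by (simp add: reflection_def)

text \<open>With \<open>c = 2 / |u|^2\<close> the cross terms \<open>- 2 c u u^T\<close> and the
  square \<open>c^2 |u|^2 u u^T\<close> cancel, because \<open>c * |u|^2 = 2\<close>.\<close>

lemma reflection_orthogonal:
  assumes "(\<Sum>k<n. (u k)\<^sup>2) \<noteq> 0"
  shows "reflection n u \<in> orthogonal_group n"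
proof -
  let ?N = "\<Sum>k<n. (u k)\<^sup>2"
  define c where "c = 2 / ?N"
  have c: "c * ?N = 2" using assms by (simp add: c_def)
  have "(\<Sum>k<n. ((if k = i then 1 else 0) - c * u k * u i) * ((if k = j then 1 else 0) - c * u k * u j))
      = (if i = j then 1 else 0)" if ij: "i < n" "j < n" for i j
  proof -
    have "(\<Sum>k<n. ((if k = i then 1 else 0) - c * u k * u i) * ((if k = j then 1 else 0) - c * u k * u j))
      = (\<Sum>k<n. (if k = i then (if i = j then 1 else 0) else 0) - (if k = i then c * u i * u j else 0)
          - (if k = j then c * u i * u j else 0) + (c * u i * u j) * (c * (u k)\<^sup>2))"
      by (intro sum.cong refl) (auto simp: algebra_simps power2_eq_square)
    also have "\<dots> = (if i = j then 1 else 0) - c * u i * u j - c * u i * u j + (c * u i * u j) * (c * ?N)"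
      using ij by (simp add: sum.distrib sum_subtractf sum_distrib_left)
    finally show ?thesis unfolding c by simp
  qed
  then have "transpose_mat (reflection n u) * reflection n u = 1\<^sub>m n"
    by (intro eq_matI) (auto simp: reflection_def scalar_prod_def c_def[symmetric] atLeast0LessThan mult.assoc)
  then show ?thesis by (simp add: orthogonal_group_def)
qed

lemma orthogonal_group_mult:
  assumes "P \<in> orthogonal_group n" "Q \<in> orthogonal_group n"
  shows "P * Q \<in> orthogonal_group n"
proof -
  have P: "P \<in> carrier_mat n n" "transpose_mat P * P = 1\<^sub>m n" and Q: "Q \<in> carrier_mat n n" "transpose_mat Q * Q = 1\<^sub>m n"
    using assms by (auto simp: orthogonal_group_def)
  have "transpose_mat (P * Q) * (P * Q) = transpose_mat Q * (transpose_mat P * P * Q)"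
    using P(1) Q(1) by (simp add: transpose_mult[OF P(1) Q(1)] assoc_mult_mat[of _ n n _ n _ n])
  then show ?thesis using P Q by (simp add: orthogonal_group_def)
qed

lemma orthogonal_group_col_norm:
  assumes "U \<in> orthogonal_group n" "i < n"
  shows "(\<Sum>k<n. (U $$ (k, i))\<^sup>2) = 1"
proof -
  have U: "U \<in> carrier_mat n n" "transpose_mat U * U = 1\<^sub>m n" using assms by (auto simp: orthogonal_group_def)
  have "(transpose_mat U * U) $$ (i, i) = (\<Sum>k<n. (U $$ (k, i))\<^sup>2)"
    using U(1) assms(2) by (simp add: scalar_prod_def atLeast0LessThan power2_eq_square)
  then show ?thesis using U assms by simp
qed

lemma orthogonal_group_entry_le:
  assumes "U \<in> orthogonal_group n" "i < n" "j < n"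
  shows "\<bar>U $$ (i, j)\<bar> \<le> 1"
proof -
  have "(U $$ (i, j))\<^sup>2 \<le> (\<Sum>k<n. (U $$ (k, j))\<^sup>2)"
    using assms by (intro member_le_sum) auto
  then show ?thesis using orthogonal_group_col_norm[OF assms(1,3)] by (simp add: abs_square_le_1)
qed

definition perturbed :: "nat \<Rightarrow> (nat \<Rightarrow> complex) \<Rightarrow> real mat \<Rightarrow> complex mat" where
  "perturbed n d U = mat_diag n d + map_mat complex_of_real U"

lemma perturbed_carrier [simp]: "U \<in> carrier_mat n n \<Longrightarrow> perturbed n d U \<in> carrier_mat n n"
  by (simp add: perturbed_def)

lemma perturbed_entry:
  "U \<in> carrier_mat n n \<Longrightarrow> i < n \<Longrightarrow> j < n \<Longrightarrow>
    perturbed n d U $$ (i, j) = (if i = j then d i else 0) + complex_of_real (U $$ (i, j))"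
  by (auto simp: perturbed_def mat_diag_def)

definition cvec :: "nat \<Rightarrow> (nat \<Rightarrow> real) \<Rightarrow> complex vec" where
  "cvec n u = vec n (\<lambda>i. complex_of_real (u i))"

lemma cvec_carrier [simp]: "cvec n u \<in> carrier_vec n"
  and dim_cvec [simp]: "dim_vec (cvec n u) = n"
  and cvec_index [simp]: "i < n \<Longrightarrow> cvec n u $ i = complex_of_real (u i)"
  by (simp_all add: cvec_def)

text \<open>Replacing \<open>U\<close> by \<open>H U\<close> subtracts the rank-one matrix
  \<open>(2 / |u|^2) u (u^T U)\<close>, so the image of \<open>y\<close> changes only in the
  direction \<open>u\<close>.\<close>

lemma perturbed_reflection_mult_vec:
  assumes U: "U \<in> carrier_mat n n" and y: "y \<in> carrier_vec n"
  shows "perturbed n d (reflection n u * U) *\<^sub>v y = perturbed n d U *\<^sub>v y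
      - (2 / of_real (\<Sum>k<n. (u k)\<^sup>2) * (cvec n u \<bullet> (map_mat complex_of_real U *\<^sub>v y))) \<cdot>\<^sub>v cvec n u"
proof (rule eq_vecI)
  let ?N = "\<Sum>k<n. (u k)\<^sup>2"
  define c where "c = 2 / ?N"
  fix i assume "i < dim_vec (perturbed n d U *\<^sub>v y
      - (2 / of_real ?N * (cvec n u \<bullet> (map_mat complex_of_real U *\<^sub>v y))) \<cdot>\<^sub>v cvec n u)"
  then have i: "i < n" by simp
  have HU: "(reflection n u * U) $$ (i, j) = U $$ (i, j) - c * u i * (\<Sum>k<n. u k * U $$ (k, j))" if "j < n" for j
  proof -
    have "(reflection n u * U) $$ (i, j) = (\<Sum>k<n. ((if i = k then 1 else 0) - c * u i * u k) * U $$ (k, j))"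
      using i that U by (simp add: scalar_prod_def atLeast0LessThan reflection_def c_def)
    also have "\<dots> = (\<Sum>k<n. (if i = k then U $$ (k, j) else 0) - c * u i * (u k * U $$ (k, j)))"
      by (intro sum.cong) (auto simp: algebra_simps)
    also have "\<dots> = U $$ (i, j) - c * u i * (\<Sum>k<n. u k * U $$ (k, j))"
      using i by (simp add: sum_subtractf sum_distrib_left)
    finally show ?thesis .
  qed
  have "(perturbed n d (reflection n u * U) *\<^sub>v y) $ i
      = (\<Sum>j<n. perturbed n d (reflection n u * U) $$ (i, j) * y $ j)"
    by (rule mult_mat_vec_index_sum[OF perturbed_carrier y i]) (use U in \<open>simp add: mult_carrier_mat[of _ n n]\<close>)
  also have "\<dots> = (\<Sum>j<n. perturbed n d U $$ (i, j) * y $ j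
      - of_real c * of_real (u i) * (\<Sum>k<n. of_real (u k) * (of_real (U $$ (k, j)) * y $ j)))"
    using i U by (intro sum.cong refl)
      (simp add: perturbed_entry mult_carrier_mat[of _ n n] HU algebra_simps sum_distrib_left)
  also have "\<dots> = (\<Sum>j<n. perturbed n d U $$ (i, j) * y $ j)
      - of_real c * of_real (u i) * (\<Sum>j<n. \<Sum>k<n. of_real (u k) * (of_real (U $$ (k, j)) * y $ j))"
    by (simp add: sum_subtractf sum_distrib_left)
  also have "(\<Sum>j<n. \<Sum>k<n. of_real (u k) * (of_real (U $$ (k, j)) * y $ j))
      = cvec n u \<bullet> (map_mat complex_of_real U *\<^sub>v y)"
    using U y by (subst sum.swap) (simp add: scalar_prod_def atLeast0LessThan sum_distrib_left)
  also have "(\<Sum>j<n. perturbed n d U $$ (i, j) * y $ j) = (perturbed n d U *\<^sub>v y) $ i"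
    using i U y by (intro mult_mat_vec_index_sum[symmetric]) auto
  finally show "(perturbed n d (reflection n u * U) *\<^sub>v y) $ i = (perturbed n d U *\<^sub>v y
      - (2 / of_real ?N * (cvec n u \<bullet> (map_mat complex_of_real U *\<^sub>v y))) \<cdot>\<^sub>v cvec n u) $ i"
    using i U y by (simp add: c_def)
qed (simp_all add: perturbed_def reflection_def)

text \<open>Bilinear, without conjugation: the rank-one update produces \<open>u^T G u\<close>, and
  along a line the form is a polynomial in the complex parameter.\<close>

definition qform :: "complex mat \<Rightarrow> complex vec \<Rightarrow> complex" where
  "qform M x = x \<bullet> (M *\<^sub>v x)"

lemma qform_line:
  assumes M: "M \<in> carrier_mat n n" and x: "x \<in> carrier_vec n" and f: "f \<in> carrier_vec n"
  shows "qform M (x + c \<cdot>\<^sub>v f) = c\<^sup>2 * qform M f + c * (x \<bullet> (M *\<^sub>v f) + f \<bullet> (M *\<^sub>v x)) + qform M x"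
proof -
  have [simp]: "M *\<^sub>v (x + c \<cdot>\<^sub>v f) = M *\<^sub>v x + c \<cdot>\<^sub>v (M *\<^sub>v f)"
    using assms by (simp add: mult_add_distrib_mat_vec[OF M] mult_mat_vec)
  have [simp]: "M *\<^sub>v x \<in> carrier_vec n" "M *\<^sub>v f \<in> carrier_vec n" using assms by auto
  show ?thesis unfolding qform_def using assms
    by (simp add: scalar_prod_add_distrib[of _ n] add_scalar_prod_distrib[of _ n] algebra_simps power2_eq_square)
qed

lemma qform_sum:
  assumes "M \<in> carrier_mat n n" "x \<in> carrier_vec n"
  shows "qform M x = (\<Sum>i<n. \<Sum>j<n. x $ i * x $ j * M $$ (i, j))"
  using assms unfolding qform_def
  by (simp add: scalar_prod_def atLeast0LessThan sum_distrib_left algebra_simps)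

text \<open>By polarization a quadratic form is controlled by its values at the vectors \<open>e\<^sub>i + e\<^sub>j\<close>, whereas it may
  vanish at all \<open>e\<^sub>i\<close>. Random vectors are therefore drawn below as combinations of all \<open>e\<^sub>i + e\<^sub>j\<close>, with independent
  uniform coefficients in \<open>{1..m}\<close>; varying a single coefficient already gives anti-concentration.\<close>

definition pair_vec :: "nat \<Rightarrow> nat \<Rightarrow> nat \<Rightarrow> complex vec" where
  "pair_vec n i j = unit_vec n i + unit_vec n j"

lemma pair_vec_carrier [simp]: "pair_vec n i j \<in> carrier_vec n"
  by (simp add: pair_vec_def)

lemma qform_pair_vec:
  assumes M: "M \<in> carrier_mat n n" and ij: "i < n" "j < n"
  shows "qform M (pair_vec n i j) = M $$ (i, i) + M $$ (i, j) + M $$ (j, i) + M $$ (j, j)"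
proof -
  have e: "unit_vec n k \<bullet> (M *\<^sub>v unit_vec n l) = M $$ (k, l)" if "k < n" "l < n" for k l
    using that M by (simp add: scalar_prod_left_unit[of _ n] scalar_prod_right_unit[of _ n] mult_mat_vec_index_sum[of _ n n])
  have "qform M (pair_vec n i j) = qform M (unit_vec n i + 1 \<cdot>\<^sub>v unit_vec n j)"
    by (simp add: pair_vec_def)
  also have "\<dots> = M $$ (i, i) + M $$ (i, j) + M $$ (j, i) + M $$ (j, j)"
    using M ij by (subst qform_line[OF M]) (simp_all add: qform_def e)
  finally show ?thesis .
qed

text \<open>\<open>M\<close> need not be symmetric, so the values at pair vectors control only the
  sums \<open>M $$ (i, j) + M $$ (j, i)\<close>; hence twice the form is symmetrized before its
  terms are estimated.\<close>

lemma qform_bound: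
  fixes x :: "complex vec"
  assumes M: "M \<in> carrier_mat n n" and x: "x \<in> carrier_vec n"
    and S: "\<And>i j. i < n \<Longrightarrow> j < n \<Longrightarrow> cmod (qform M (pair_vec n i j)) \<le> S"
    and a: "\<And>i. i < n \<Longrightarrow> cmod (x $ i) \<le> a"
  shows "cmod (qform M x) \<le> (real n)\<^sup>2 * a\<^sup>2 * S"
proof -
  \<comment> \<open>For equal indices the pair vector is twice a unit vector, where the form takes
    the value \<open>4 * M $$ (i, i)\<close>.\<close>
  have diag: "cmod (M $$ (i, i)) \<le> S / 4" if "i < n" for i
    using S[OF that that] that by (simp add: qform_pair_vec[OF M] norm_mult flip: mult_2)
  have off: "cmod (M $$ (i, j) + M $$ (j, i)) \<le> 2 * S" if "i < n" "j < n" for i j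
  proof -
    have "M $$ (i, j) + M $$ (j, i) = qform M (pair_vec n i j) - M $$ (i, i) - M $$ (j, j)"
      using that by (simp add: qform_pair_vec[OF M])
    also have "cmod \<dots> \<le> cmod (qform M (pair_vec n i j)) + cmod (M $$ (i, i)) + cmod (M $$ (j, j))"
      by (metis add_right_mono norm_triangle_ineq4 order_trans)
    finally show ?thesis using S[OF that] diag[OF that(1)] diag[OF that(2)] order_trans[OF norm_ge_zero S[OF that]]
      by linarith
  qed
  have "2 * qform M x = (\<Sum>i<n. \<Sum>j<n. x $ i * x $ j * M $$ (i, j)) + (\<Sum>i<n. \<Sum>j<n. x $ j * x $ i * M $$ (j, i))"
    by (subst (2) sum.swap) (simp add: qform_sum[OF M x])
  also have "\<dots> = (\<Sum>i<n. \<Sum>j<n. x $ i * x $ j * (M $$ (i, j) + M $$ (j, i)))"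
    unfolding sum.distrib[symmetric] by (intro sum.cong refl) (simp add: algebra_simps)
  also have "cmod \<dots> \<le> (\<Sum>i<n. \<Sum>j<n. a * a * (2 * S))"
  proof (intro sum_norm_le)
    fix i j assume "i \<in> {..<n}" "j \<in> {..<n}"
    then show "cmod (x $ i * x $ j * (M $$ (i, j) + M $$ (j, i))) \<le> a * a * (2 * S)"
      unfolding norm_mult using a off
      by (intro mult_mono mult_nonneg_nonneg) (auto intro: order_trans[OF norm_ge_zero a])
  qed
  finally show ?thesis by (simp add: norm_mult power2_eq_square)
qed

section \<open>Random integer vectors and their anti-concentration\<close>

definition grid :: "nat \<Rightarrow> nat \<Rightarrow> (nat \<times> nat \<Rightarrow> nat) set" where
  "grid n m = ({..<n} \<times> {..<n}) \<rightarrow>\<^sub>E {1..m}"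

text \<open>The coordinate \<open>k\<close> of the sum of \<open>s (i, j) * (e_i + e_j)\<close> over
  all ordered pairs.\<close>

definition grid_vec :: "nat \<Rightarrow> (nat \<times> nat \<Rightarrow> nat) \<Rightarrow> nat \<Rightarrow> real" where
  "grid_vec n s k = (\<Sum>j<n. real (s (k, j)) + real (s (j, k)))"

lemma finite_grid [simp]: "finite (grid n m)"
  by (simp add: grid_def finite_PiE)

lemma grid_entry:
  assumes "s \<in> grid n m" "i < n" "j < n"
  shows "1 \<le> s (i, j)" "s (i, j) \<le> m"
  using assms PiE_mem[of s "{..<n} \<times> {..<n}" "\<lambda>_. {1..m}" "(i, j)"] by (auto simp: grid_def)

lemma grid_vec_bounds:
  assumes "s \<in> grid n m" "k < n"
  shows "1 \<le> grid_vec n s k" "grid_vec n s k \<le> 2 * real n * real m"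
proof -
  have "(\<Sum>j<n. 2::real) \<le> grid_vec n s k"
    unfolding grid_vec_def using grid_entry[OF assms(1)] assms(2)
    by (intro sum_mono) (smt (verit) lessThan_iff of_nat_1 of_nat_le_iff)
  then show "1 \<le> grid_vec n s k" using assms(2) by simp
  have "grid_vec n s k \<le> (\<Sum>j<n. 2 * real m)"
    unfolding grid_vec_def using grid_entry[OF assms(1)] assms(2)
    by (intro sum_mono) (smt (verit) lessThan_iff of_nat_le_iff)
  then show "grid_vec n s k \<le> 2 * real n * real m" by (simp add: algebra_simps)
qed

lemma grid_vec_norm:
  assumes "s \<in> grid n m" "0 < n"
  shows "0 < (\<Sum>k<n. (grid_vec n s k)\<^sup>2)" "(\<Sum>k<n. (grid_vec n s k)\<^sup>2) \<le> 4 * real n ^ 3 * (real m)\<^sup>2"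
proof -
  show "0 < (\<Sum>k<n. (grid_vec n s k)\<^sup>2)"
    using grid_vec_bounds(1)[OF assms(1)] assms(2)
    by (intro sum_pos) (auto, force)
  have "(\<Sum>k<n. (grid_vec n s k)\<^sup>2) \<le> (\<Sum>k<n. (2 * real n * real m)\<^sup>2)"
    using grid_vec_bounds[OF assms(1)] by (intro sum_mono power_mono) force+
  then show "(\<Sum>k<n. (grid_vec n s k)\<^sup>2) \<le> 4 * real n ^ 3 * (real m)\<^sup>2"
    by (simp add: power2_eq_square power3_eq_cube algebra_simps)
qed

lemma grid_vec_upd:
  assumes "i < n" "j < n" "k < n"
  shows "grid_vec n (s((i, j) := x)) k
    = grid_vec n (s((i, j) := 0)) k + real x * ((if k = i then 1 else 0) + (if k = j then 1 else 0))"
proof -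
  have "grid_vec n (s((i, j) := x)) k = (\<Sum>l<n. (real ((s((i, j) := 0)) (k, l)) + real ((s((i, j) := 0)) (l, k)))
      + ((if l = j then (if k = i then real x else 0) else 0) + (if l = i then (if k = j then real x else 0) else 0)))"
    unfolding grid_vec_def by (intro sum.cong) auto
  also have "\<dots> = grid_vec n (s((i, j) := 0)) k + ((if k = i then real x else 0) + (if k = j then real x else 0))"
    using assms by (simp add: sum.distrib grid_vec_def)
  finally show ?thesis by (simp add: algebra_simps)
qed

text \<open>Varying the coefficient at \<open>(k, k)\<close> moves the vector along
  \<open>2 e_k\<close>, so the linear form has slope \<open>2 * w k\<close> there, and
  \<open>cmod (w k)\<close> is half of that slope.\<close>

lemma grid_linear_small:
  fixes w :: "nat \<Rightarrow> complex"
  assumes k: "k < n" and w: "w k \<noteq> 0"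
  shows "m * card {s \<in> grid n m. cmod (\<Sum>l<n. w l * of_real (grid_vec n s l)) < cmod (w k)} \<le> card (grid n m)"
proof -
  let ?B = "{s \<in> grid n m. cmod (\<Sum>l<n. w l * of_real (grid_vec n s l)) < cmod (w k)}"
  have "m * card ?B \<le> 1 * card ({..<n} \<times> {..<n} \<rightarrow>\<^sub>E {1..m})"
  proof (rule card_PiE_slices_le[where f = "(k, k)"])
    fix s
    define b where "b = (\<Sum>l<n. w l * of_real (grid_vec n (s((k, k) := 0)) l))"
    have "(\<Sum>l<n. w l * of_real (grid_vec n (s((k, k) := x)) l)) = of_nat x * (2 * w k) + b" for x
    proof -
      have "(\<Sum>l<n. w l * of_real (grid_vec n (s((k, k) := x)) l))
          = (\<Sum>l<n. w l * of_real (grid_vec n (s((k, k) := 0)) l) + (if l = k then of_nat x * (2 * w k) else 0))"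
        using k by (intro sum.cong) (auto simp: grid_vec_upd[of k n k _ s x] algebra_simps)
      then show ?thesis using k by (simp add: sum.distrib b_def)
    qed
    then have "{x \<in> {1..m}. s((k, k) := x) \<in> ?B} \<subseteq> {x \<in> {1..m}. cmod (of_nat x * (2 * w k) + b) < cmod (2 * w k) / 2}"
      by (auto simp: norm_mult)
    then have "card {x \<in> {1..m}. s((k, k) := x) \<in> ?B} \<le> card {x \<in> {1..m}. cmod (of_nat x * (2 * w k) + b) < cmod (2 * w k) / 2}"
      by (intro card_mono) auto
    also have "\<dots> \<le> 1" using w by (intro card_linear_small_le) auto
    finally show "card {x \<in> {1..m}. s((k, k) := x) \<in> ?B} \<le> 1" .
  qed (use k in \<open>auto simp: grid_def\<close>)
  then show ?thesis by (simp add: grid_def)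
qed

text \<open>Varying the coefficient at \<open>(i, j)\<close> moves the vector along
  \<open>e_i + e_j\<close>; the form becomes a quadratic polynomial whose leading coefficient is its
  value at that pair vector.\<close>

lemma grid_qform_small:
  assumes M: "M \<in> carrier_mat n n" and ij: "i < n" "j < n" and nz: "qform M (pair_vec n i j) \<noteq> 0"
  shows "m * card {s \<in> grid n m. cmod (qform M (cvec n (grid_vec n s))) \<le> cmod (qform M (pair_vec n i j))}
    \<le> 6 * card (grid n m)"
proof -
  let ?B = "{s \<in> grid n m. cmod (qform M (cvec n (grid_vec n s))) \<le> cmod (qform M (pair_vec n i j))}"
  have "m * card ?B \<le> 6 * card ({..<n} \<times> {..<n} \<rightarrow>\<^sub>E {1..m})"
  proof (rule card_PiE_slices_le[where f = "(i, j)"])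
    fix s
    define x0 where "x0 = cvec n (grid_vec n (s((i, j) := 0)))"
    have x0: "x0 \<in> carrier_vec n" by (simp add: x0_def)
    define b where "b = x0 \<bullet> (M *\<^sub>v pair_vec n i j) + pair_vec n i j \<bullet> (M *\<^sub>v x0)"
    have "cvec n (grid_vec n (s((i, j) := x))) = x0 + of_nat x \<cdot>\<^sub>v pair_vec n i j" for x
      using ij by (intro eq_vecI) (auto simp: x0_def pair_vec_def grid_vec_upd[of i n j _ s x])
    then have e: "qform M (cvec n (grid_vec n (s((i, j) := x))))
        = (of_nat x)\<^sup>2 * qform M (pair_vec n i j) + of_nat x * b + qform M x0" for x
      using qform_line[OF M x0 pair_vec_carrier] by (simp only: b_def)
    have "card {x \<in> {1..m}. s((i, j) := x) \<in> ?B} \<le> card {x \<in> {1..m}.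
        cmod ((of_nat x)\<^sup>2 * qform M (pair_vec n i j) + of_nat x * b + qform M x0) \<le> cmod (qform M (pair_vec n i j))}"
      unfolding mem_Collect_eq e by (rule card_mono, simp, blast)
    also have "\<dots> \<le> 6" by (rule card_quadratic_small_le[OF nz])
    finally show "card {x \<in> {1..m}. s((i, j) := x) \<in> ?B} \<le> 6" .
  qed (use ij in \<open>auto simp: grid_def\<close>)
  then show ?thesis by (simp add: grid_def)
qed

section \<open>The inverse of \<open>D + U\<close> and the quadratic form of
  \<open>2 G - 1\<close>\<close>

locale inverse_perturbed =
  fixes n :: nat and d :: "nat \<Rightarrow> complex" and U :: "real mat" and B :: "complex mat"
  assumes U: "U \<in> orthogonal_group n" and B [simp]: "B \<in> carrier_mat n n"
    and AB: "perturbed n d U * B = 1\<^sub>m n" and BA: "B * perturbed n d U = 1\<^sub>m n"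
begin

abbreviation "A \<equiv> perturbed n d U"
abbreviation "V \<equiv> map_mat complex_of_real U"

lemma U_carrier [simp]: "U \<in> carrier_mat n n"
  using U by (simp add: orthogonal_group_def)

lemma A_carrier [simp]: "A \<in> carrier_mat n n" by simp

lemma A_dims [simp]: "dim_row A = n" "dim_col A = n" "dim_row B = n" "dim_col B = n" "dim_row U = n" "dim_col U = n"
  using carrier_matD[OF A_carrier] carrier_matD[OF B] carrier_matD[OF U_carrier] by auto

definition "G = V * B"
definition "M = 2 \<cdot>\<^sub>m G - 1\<^sub>m n"

lemma G_carrier [simp]: "G \<in> carrier_mat n n"
  and M_carrier [simp]: "M \<in> carrier_mat n n"
  by (auto simp: M_def G_def intro!: mult_carrier_mat[of _ n n] minus_carrier_mat)

lemma B_A [simp]: "x \<in> carrier_vec n \<Longrightarrow> B *\<^sub>v (A *\<^sub>v x) = x"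
  using assoc_mult_mat_vec[of B n n A n x] by (simp add: BA)

lemma A_B [simp]: "x \<in> carrier_vec n \<Longrightarrow> A *\<^sub>v (B *\<^sub>v x) = x"
  using assoc_mult_mat_vec[of A n n B n x] by (simp add: AB)

lemma G_vec: "x \<in> carrier_vec n \<Longrightarrow> G *\<^sub>v x = V *\<^sub>v (B *\<^sub>v x)"
  unfolding G_def by (rule assoc_mult_mat_vec[of _ n n _ n]) auto

lemma M_vec: 
  assumes "x \<in> carrier_vec n" shows "M *\<^sub>v x = 2 \<cdot>\<^sub>v (G *\<^sub>v x) - x"
proof (rule eq_vecI)
  fix i assume "i < dim_vec (2 \<cdot>\<^sub>v (G *\<^sub>v x) - x)"
  then have i: "i < n" using assms by simp
  have "(M *\<^sub>v x) $ i = (\<Sum>j<n. M $$ (i, j) * x $ j)"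
    by (rule mult_mat_vec_index_sum[OF M_carrier assms i])
  also have "\<dots> = (\<Sum>j<n. 2 * (G $$ (i, j) * x $ j) - (if j = i then x $ i else 0))"
    using i carrier_matD[OF G_carrier] by (intro sum.cong) (auto simp: M_def algebra_simps)
  also have "\<dots> = 2 * (G *\<^sub>v x) $ i - x $ i"
    using i unfolding mult_mat_vec_index_sum[OF G_carrier assms i] by (simp add: sum_subtractf sum_distrib_left)
  finally show "(M *\<^sub>v x) $ i = (2 \<cdot>\<^sub>v (G *\<^sub>v x) - x) $ i"
    using i assms carrier_matD[OF G_carrier] by simp
qed (use assms carrier_matD[OF M_carrier] in simp)

lemma qform_M: 
  assumes x: "x \<in> carrier_vec n" shows "qform M x = 2 * (x \<bullet> (G *\<^sub>v x)) - x \<bullet> x"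
proof -
  have "G *\<^sub>v x \<in> carrier_vec n" using mult_mat_vec_carrier[OF G_carrier x] .
  then show ?thesis unfolding qform_def M_vec[OF x] using x by (simp add: scalar_prod_minus_distrib[of _ n])
qed

text \<open>Without inverses this reads \<open>A\<^sup>T (G + G\<^sup>T - 1) A = 1 - D\<^sup>2\<close>.\<close>

lemma qform_M_col:
  assumes i: "i < n" shows "qform M (col A i) = 1 - (d i)\<^sup>2"
proof -
  have ce: "A *\<^sub>v unit_vec n i = col A i"
    using i by (intro eq_vecI) (simp_all add: mult_mat_vec_index_sum[of _ n n] if_distrib[of "\<lambda>c. _ * c"] cong: if_cong)
  have cV: "V *\<^sub>v unit_vec n i = col V i"
    using i by (intro eq_vecI) (simp_all add: scalar_prod_right_unit[of _ n])
  have "G *\<^sub>v col A i = V *\<^sub>v (B *\<^sub>v (A *\<^sub>v unit_vec n i))"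
    by (subst ce) (rule G_vec, use i in \<open>simp add: carrier_vecI\<close>)
  also have "\<dots> = col V i" using i by (simp add: cV)
  finally have "qform M (col A i) = 2 * (col A i \<bullet> col V i) - col A i \<bullet> col A i"
    by (subst qform_M) (simp_all add: carrier_vecI)
  also have "\<dots> = (\<Sum>k<n. 2 * (A $$ (k, i) * V $$ (k, i)) - A $$ (k, i) * A $$ (k, i))"
    using i by (simp add: scalar_prod_def atLeast0LessThan sum_subtractf sum_distrib_left)
  \<comment> \<open>Each summand is \<open>A (2 V - A) = (V + D) (V - D)\<close>, entrywise, and
    \<open>D\<close> contributes only at \<open>k = i\<close>.\<close>
  also have "\<dots> = (\<Sum>k<n. of_real ((U $$ (k, i))\<^sup>2) - (if k = i then (d i)\<^sup>2 else 0))"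
    using i by (intro sum.cong) (auto simp: perturbed_entry power2_eq_square algebra_simps)
  also have "\<dots> = of_real (\<Sum>k<n. (U $$ (k, i))\<^sup>2) - (d i)\<^sup>2" using i by (simp add: sum_subtractf)
  finally show ?thesis using orthogonal_group_col_norm[OF U i] by simp
qed

end

section \<open>How a reflection changes the inverse\<close>

locale reflected_inverse_perturbed = inverse_perturbed +
  fixes u :: "nat \<Rightarrow> real"
  assumes u: "(\<Sum>k<n. (u k)\<^sup>2) \<noteq> 0"
begin

abbreviation "A' \<equiv> perturbed n d (reflection n u * U)"
abbreviation "w \<equiv> cvec n u"
abbreviation "N \<equiv> complex_of_real (\<Sum>k<n. (u k)\<^sup>2)"

lemma A'_carrier [simp]: "A' \<in> carrier_mat n n"
  by (rule perturbed_carrier) (simp add: mult_carrier_mat[of _ n n])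

lemma N_nz [simp]: "N \<noteq> 0"
  using u by (metis of_real_eq_0_iff)

lemma w_w: "w \<bullet> w = N"
  by (simp add: scalar_prod_def atLeast0LessThan power2_eq_square)

lemma A'_vec: "y \<in> carrier_vec n \<Longrightarrow> A' *\<^sub>v y = A *\<^sub>v y - (2 / N * (w \<bullet> (V *\<^sub>v y))) \<cdot>\<^sub>v w"
  by (rule perturbed_reflection_mult_vec) simp

lemma A_vec: 
  assumes y: "y \<in> carrier_vec n"
  shows "A *\<^sub>v y = A' *\<^sub>v y + (2 / N * (w \<bullet> (V *\<^sub>v y))) \<cdot>\<^sub>v w"
proof -
  have "A *\<^sub>v y \<in> carrier_vec n" using mult_mat_vec_carrier[OF _ y, of A n] by simp
  then show ?thesis unfolding A'_vec[OF y] by (intro eq_vecI) auto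
qed

lemma V_y:
  assumes y: "y \<in> carrier_vec n" and yc: "y = c \<cdot>\<^sub>v (B *\<^sub>v w)"
  shows "w \<bullet> (V *\<^sub>v y) = c * (w \<bullet> (G *\<^sub>v w))"
proof -
  have b: "B *\<^sub>v w \<in> carrier_vec n" using mult_mat_vec_carrier[OF B] by simp
  have "V *\<^sub>v (B *\<^sub>v w) \<in> carrier_vec n" using mult_mat_vec_carrier[OF _ b, of V n] by simp
  then show ?thesis unfolding yc by (simp add: mult_mat_vec[OF _ b, of V n] G_vec scalar_prod_smult_distrib[of _ n])
qed

text \<open>Since \<open>A'\<close> and \<open>A\<close> differ only in the direction
  \<open>w\<close>, \<open>A *\<^sub>v y\<close> is also a multiple of \<open>w\<close>, hence
  \<open>y\<close> is a multiple of \<open>B *\<^sub>v w\<close>; inserting this back determines the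
  factor. The relation stays undivided because \<open>qform M w\<close> may vanish, and
  \<open>e = 0\<close> and \<open>e = 1\<close> then cover the kernel and the inverse of
  \<open>A'\<close>.\<close>

lemma solve_reflected:
  assumes y: "y \<in> carrier_vec n" and eq: "A' *\<^sub>v y = e \<cdot>\<^sub>v w"
  obtains c where "y = c \<cdot>\<^sub>v (B *\<^sub>v w)" "c * qform M w = - e * N"
proof -
  define c where "c = e + 2 / N * (w \<bullet> (V *\<^sub>v y))"
  have "A *\<^sub>v y = c \<cdot>\<^sub>v w" unfolding A_vec[OF y] eq c_def by (intro eq_vecI) (auto simp: algebra_simps)
  then have "B *\<^sub>v (A *\<^sub>v y) = c \<cdot>\<^sub>v (B *\<^sub>v w)" by (simp add: mult_mat_vec[OF B])
  then have yc: "y = c \<cdot>\<^sub>v (B *\<^sub>v w)" using y by simp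
  have "c = e + 2 / N * (c * (w \<bullet> (G *\<^sub>v w)))" using V_y[OF y yc] unfolding c_def by simp
  then have "c * N = e * N + 2 * c * (w \<bullet> (G *\<^sub>v w))" using N_nz by (simp add: field_simps del: of_real_sum N_nz)
  then have "c * qform M w = - e * N" by (simp add: qform_M w_w algebra_simps)
  with yc show thesis by (rule that)
qed

text \<open>A kernel vector of \<open>A'\<close> is \<open>c\<close> times
  \<open>B *\<^sub>v w\<close>; it is nonzero, so \<open>c\<close> is nonzero and the equation for
  \<open>c\<close> forces the form to vanish.\<close>

lemma reflected_singular:
  assumes "det A' = 0"
  shows "qform M w = 0"
proof -
  obtain y where y: "y \<in> carrier_vec n" "y \<noteq> 0\<^sub>v n" "A' *\<^sub>v y = 0\<^sub>v n"
    using assms det_0_iff_vec_prod_zero[OF A'_carrier] by auto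
  have "A' *\<^sub>v y = 0 \<cdot>\<^sub>v w" unfolding y(3) by (intro eq_vecI) auto
  from solve_reflected[OF y(1) this] obtain c where c: "y = c \<cdot>\<^sub>v (B *\<^sub>v w)" "c * qform M w = 0" by auto
  have "c \<noteq> 0" using c(1) y(2) by (auto intro!: eq_vecI simp: carrier_vecI)
  then show ?thesis using c(2) by simp
qed

lemma reflected_inverse_apply:
  assumes B': "B' \<in> carrier_mat n n" and A'B': "A' * B' = 1\<^sub>m n"
  obtains c where "B' *\<^sub>v w = c \<cdot>\<^sub>v (B *\<^sub>v w)" "c * qform M w = - N"
proof (rule solve_reflected)
  show "B' *\<^sub>v w \<in> carrier_vec n" using mult_mat_vec_carrier[OF B'] by simp
  show "A' *\<^sub>v (B' *\<^sub>v w) = 1 \<cdot>\<^sub>v w"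
    using assoc_mult_mat_vec[OF A'_carrier B', of w] by (simp add: A'B')
qed (use that in auto)

text \<open>The Sherman-Morrison formula with its denominator multiplied out: \<open>A'\<close> maps
  column \<open>j\<close> of \<open>B\<close> to \<open>e_j\<close> minus a multiple of
  \<open>w\<close>; apply \<open>B'\<close> and insert the known
  \<open>B' *\<^sub>v w\<close>.\<close>

lemma reflected_inverse_entry:
  assumes B': "B' \<in> carrier_mat n n" and A'B': "A' * B' = 1\<^sub>m n" and B'A': "B' * A' = 1\<^sub>m n"
    and ij: "i < n" "j < n"
  shows "(B' $$ (i, j) - B $$ (i, j)) * qform M w = - 2 * (w \<bullet> col G j) * (B *\<^sub>v w) $ i"
proof -
  obtain c where c: "B' *\<^sub>v w = c \<cdot>\<^sub>v (B *\<^sub>v w)" "c * qform M w = - N"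
    using reflected_inverse_apply[OF B' A'B'] by blast
  let ?e = "unit_vec n j"
  have z: "B *\<^sub>v ?e \<in> carrier_vec n" using mult_mat_vec_carrier[OF B] by simp
  have colG: "G *\<^sub>v ?e = col G j"
    using ij by (intro eq_vecI) (simp_all add: scalar_prod_right_unit[of _ n] G_def)
  define k where "k = 2 / N * (w \<bullet> col G j)"
  have "A' *\<^sub>v (B *\<^sub>v ?e) = ?e - k \<cdot>\<^sub>v w"
    unfolding A'_vec[OF z] k_def using ij by (simp add: G_vec colG[symmetric])
  then have "B' *\<^sub>v (A' *\<^sub>v (B *\<^sub>v ?e)) = B' *\<^sub>v ?e - k \<cdot>\<^sub>v (B' *\<^sub>v w)"
    by (simp add: mult_minus_distrib_mat_vec[OF B'] mult_mat_vec[OF B'])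
  moreover have "B' *\<^sub>v (A' *\<^sub>v (B *\<^sub>v ?e)) = B *\<^sub>v ?e"
    using assoc_mult_mat_vec[OF B' A'_carrier z] z by (simp add: B'A')
  ultimately have "(B *\<^sub>v ?e) $ i = (B' *\<^sub>v ?e - (k * c) \<cdot>\<^sub>v (B *\<^sub>v w)) $ i"
    by (simp add: c(1) smult_smult_assoc)
  also have "\<dots> = (B' *\<^sub>v ?e) $ i - k * c * (B *\<^sub>v w) $ i"
    using ij B' carrier_matD[OF B] by simp
  finally have "B' $$ (i, j) - B $$ (i, j) = k * c * (B *\<^sub>v w) $ i"
    using ij B' carrier_matD[OF B] by (simp add: scalar_prod_right_unit[of _ n])
  then have "(B' $$ (i, j) - B $$ (i, j)) * qform M w = k * (c * qform M w) * (B *\<^sub>v w) $ i" by simp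
  then show ?thesis unfolding c(2) using N_nz by (simp add: k_def del: of_real_sum N_nz)
qed

end

subsection \<open>The dichotomy for a fixed orthogonal matrix\<close>

text \<open>Some entry of \<open>(D + U)\<^sup>-\<^sup>1\<close> has modulus at least \<open>T\<close>, or the inverse does not exist; written
  with the adjugate, so that the event is measurable and no division by a zero determinant occurs.\<close>

definition near_singular :: "nat \<Rightarrow> (nat \<Rightarrow> complex) \<Rightarrow> real \<Rightarrow> real mat \<Rightarrow> bool" where
  "near_singular n d T U \<longleftrightarrow> det (perturbed n d U) = 0 \<or>
    (\<exists>i<n. \<exists>j<n. T * cmod (det (perturbed n d U)) \<le> cmod (adj_mat (perturbed n d U) $$ (i, j)))"

definition near_singular_along :: "nat \<Rightarrow> (nat \<Rightarrow> complex) \<Rightarrow> real \<Rightarrow> (nat \<Rightarrow> real) \<Rightarrow> real mat \<Rightarrow> bool" where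
  "near_singular_along n d T u U \<longleftrightarrow> det (perturbed n d U) = 0 \<or>
    (\<exists>i<n. T * cmod (det (perturbed n d U)) \<le> cmod (\<Sum>j<n. adj_mat (perturbed n d U) $$ (i, j) * of_real (u j)))"

text \<open>The inverse by Cramer's rule; it is the zero matrix when the determinant
  vanishes.\<close>

definition scaled_adj :: "complex mat \<Rightarrow> complex mat" where
  "scaled_adj A = inverse (det A) \<cdot>\<^sub>m adj_mat A"

lemma scaled_adj:
  assumes A: "A \<in> carrier_mat n n" and "det A \<noteq> 0"
  shows "scaled_adj A \<in> carrier_mat n n" "A * scaled_adj A = 1\<^sub>m n" "scaled_adj A * A = 1\<^sub>m n"
proof -
  note adj = adj_mat[OF A]
  show "scaled_adj A \<in> carrier_mat n n" using adj by (simp add: scaled_adj_def)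
  have s: "inverse (det A) \<cdot>\<^sub>m (det A \<cdot>\<^sub>m 1\<^sub>m n) = 1\<^sub>m n"
    using assms by (intro eq_matI) auto
  show "A * scaled_adj A = 1\<^sub>m n"
    unfolding scaled_adj_def by (subst mult_smult_distrib[OF A adj(1)]) (simp add: adj s)
  show "scaled_adj A * A = 1\<^sub>m n"
    unfolding scaled_adj_def by (subst mult_smult_assoc_mat[OF adj(1) A]) (simp add: adj s)
qed

lemma scaled_adj_index:
  "A \<in> carrier_mat n n \<Longrightarrow> i < n \<Longrightarrow> j < n \<Longrightarrow> scaled_adj A $$ (i, j) = adj_mat A $$ (i, j) / det A"
  using adj_mat(1)[of A n] by (simp add: scaled_adj_def field_simps)

lemma near_singular_iff:
  assumes "U \<in> carrier_mat n n" "det (perturbed n d U) \<noteq> 0"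
  shows "near_singular n d T U \<longleftrightarrow> (\<exists>i<n. \<exists>j<n. T \<le> cmod (scaled_adj (perturbed n d U) $$ (i, j)))"
proof -
  have "T * cmod (det (perturbed n d U)) \<le> cmod (adj_mat (perturbed n d U) $$ (i, j))
      \<longleftrightarrow> T \<le> cmod (scaled_adj (perturbed n d U) $$ (i, j))" if "i < n" "j < n" for i j
    using that assms by (simp add: scaled_adj_index[OF perturbed_carrier] norm_divide pos_le_divide_eq)
  then show ?thesis using assms(2) unfolding near_singular_def by blast
qed

lemma near_singular_along_iff:
  assumes "U \<in> carrier_mat n n" "det (perturbed n d U) \<noteq> 0"
  shows "near_singular_along n d T u U \<longleftrightarrow> (\<exists>i<n. T \<le> cmod ((scaled_adj (perturbed n d U) *\<^sub>v cvec n u) $ i))"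
proof -
  let ?A = "perturbed n d U"
  have c: "scaled_adj ?A \<in> carrier_mat n n" using assms by (intro scaled_adj) auto
  have "(scaled_adj ?A *\<^sub>v cvec n u) $ i = (\<Sum>j<n. adj_mat ?A $$ (i, j) * of_real (u j)) / det ?A" if "i < n" for i
    using that assms(1) unfolding mult_mat_vec_index_sum[OF c cvec_carrier that]
    by (simp add: scaled_adj_index[OF perturbed_carrier] sum_divide_distrib)
  then show ?thesis using assms unfolding near_singular_along_def
    by (auto simp: norm_divide pos_le_divide_eq)
qed

text \<open>A row of the adjugate with a large entry has, by linear anti-concentration, an equally
  large product with all but a fraction \<open>1 / m\<close> of the grid vectors. Here
  \<open>U\<close> is fixed independently of \<open>s\<close>.\<close>

lemma card_near_singular_along_ge:
  assumes "near_singular n d T U" "0 < T" "2 \<le> m"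
  shows "card (grid n m) \<le> 2 * card {s \<in> grid n m. near_singular_along n d T (grid_vec n s) U}"
proof (cases "det (perturbed n d U) = 0")
  case True
  then show ?thesis by (simp add: near_singular_along_def)
next
  case False
  let ?A = "perturbed n d U"
  obtain i j where ij: "i < n" "j < n" "T * cmod (det ?A) \<le> cmod (adj_mat ?A $$ (i, j))"
    using assms(1) False by (auto simp: near_singular_def)
  have nz: "adj_mat ?A $$ (i, j) \<noteq> 0"
    using ij(3) assms(2) False by (smt (verit) mult_pos_pos norm_zero zero_less_norm_iff)
  let ?X = "{s \<in> grid n m. near_singular_along n d T (grid_vec n s) U}"
  let ?Y = "{s \<in> grid n m. cmod (\<Sum>l<n. adj_mat ?A $$ (i, l) * of_real (grid_vec n s l)) < cmod (adj_mat ?A $$ (i, j))}"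
  have "2 * card ?Y \<le> m * card ?Y" using assms(3) by simp
  also have "\<dots> \<le> card (grid n m)" by (rule grid_linear_small) (use ij nz in auto)
  finally have Y: "2 * card ?Y \<le> card (grid n m)" .
  have "grid n m \<subseteq> ?X \<union> ?Y"
    using ij by (fastforce simp: near_singular_along_def)
  then have "card (grid n m) \<le> card (?X \<union> ?Y)" by (intro card_mono) auto
  also have "\<dots> \<le> card ?X + card ?Y" by (rule card_Un_le)
  finally show ?thesis using Y by linarith
qed

lemma perturbed_entry_le:
  assumes "U \<in> orthogonal_group n" "i < n" "j < n" "\<And>i. i < n \<Longrightarrow> cmod (d i) \<le> K" "1 \<le> K"
  shows "cmod (perturbed n d U $$ (i, j)) \<le> 2 * K"
proof -
  have "U \<in> carrier_mat n n" using assms(1) by (simp add: orthogonal_group_def)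
  then have "cmod (perturbed n d U $$ (i, j)) \<le> cmod (if i = j then d i else 0) + \<bar>U $$ (i, j)\<bar>"
    using assms by (simp add: perturbed_entry) (metis norm_of_real norm_triangle_ineq)
  then show ?thesis
    using orthogonal_group_entry_le[OF assms(1-3)] assms(4)[OF assms(2)] assms(5) by (auto split: if_splits)
qed

context inverse_perturbed
begin

text \<open>Orthogonality gives \<open>B = U^T G\<close>, and the entries of \<open>U\<close> are at
  most 1 in modulus. A large entry of \<open>B\<close> thus forces a large entry in the same column
  of \<open>G\<close>.\<close>

lemma B_entry_le_G:
  assumes "i < n" "j < n"
  obtains k where "k < n" "cmod (B $$ (i, j)) \<le> real n * cmod (G $$ (k, j))"
proof -
  have UV: "transpose_mat V * V = 1\<^sub>m n"
  proof -
    have "transpose_mat V * V = map_mat complex_of_real (transpose_mat U * U)"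
      by (subst of_real_hom.mat_hom_mult[of _ n n _ n]) (auto intro!: arg_cong2[of _ _ _ _ "(*)"] eq_matI)
    then show ?thesis using U by (simp add: orthogonal_group_def of_real_hom.mat_hom_one)
  qed
  have e: "B = transpose_mat V * G"
    unfolding G_def by (subst assoc_mult_mat[symmetric, of _ n n _ n _ n]) (auto simp: UV)
  have "B $$ (i, j) = (transpose_mat V * G) $$ (i, j)"
    using e by (rule arg_cong)
  also have "\<dots> = (\<Sum>k<n. V $$ (k, i) * G $$ (k, j))"
    using assms carrier_matD[OF G_carrier] by (simp add: scalar_prod_def atLeast0LessThan)
  also have "cmod \<dots> \<le> (\<Sum>k<n. Max ((\<lambda>k. cmod (G $$ (k, j))) ` {..<n}))"
  proof (intro sum_norm_le)
    fix k assume k: "k \<in> {..<n}"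
    have "cmod (V $$ (k, i) * G $$ (k, j)) \<le> 1 * cmod (G $$ (k, j))"
      unfolding norm_mult using orthogonal_group_entry_le[OF U, of k i] k assms by (intro mult_right_mono) auto
    also have "\<dots> \<le> Max ((\<lambda>k. cmod (G $$ (k, j))) ` {..<n})" using k by (simp add: Max_ge)
    finally show "cmod (V $$ (k, i) * G $$ (k, j)) \<le> Max ((\<lambda>k. cmod (G $$ (k, j))) ` {..<n})" .
  qed
  finally have b: "cmod (B $$ (i, j)) \<le> real n * Max ((\<lambda>k. cmod (G $$ (k, j))) ` {..<n})" by simp
  have "Max ((\<lambda>k. cmod (G $$ (k, j))) ` {..<n}) \<in> (\<lambda>k. cmod (G $$ (k, j))) ` {..<n}"
    using assms by (intro Max_in) auto
  then show ?thesis using b that by auto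
qed

text \<open>Put \<open>R = T / (8 n^5 m^3)\<close> and compare \<open>\<tau>\<close> with
  \<open>R * S\<close>. If \<open>\<tau>\<close> is smaller, a large inverse along \<open>w\<close>
  requires \<open>qform M w\<close> to be at most \<open>S\<close>, which is rare. If it is larger,
  the update formula makes an entry of the new inverse large for most \<open>w\<close>:
  \<open>R1\<close> absorbs the contribution of the old entry, and \<open>R2\<close> lifts the new
  entry to \<open>X\<close>.\<close>

lemma reflection_dichotomy:
  fixes m :: nat and K \<eta> T X :: real
  assumes n: "0 < n" and d: "\<And>i. i < n \<Longrightarrow> cmod (d i) \<le> K" and K: "1 \<le> K"
    and i0: "i0 < n" "\<eta> \<le> cmod (1 - (d i0)\<^sup>2)" and \<eta>: "0 < \<eta>" and m: "4 \<le> m"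
    and T: "0 < T" and X: "0 < X"
    and R1: "4 * real n ^ 5 * (real m)\<^sup>2 \<le> T / (8 * real n ^ 5 * real m ^ 3)"
    and R2: "5 * real n ^ 5 * (real m)\<^sup>2 * X
      \<le> (T / (8 * real n ^ 5 * real m ^ 3))\<^sup>2 * (\<eta> / (4 * (real n)\<^sup>2 * K\<^sup>2))"
  shows "m * card {s \<in> grid n m. near_singular_along n d T (grid_vec n s) (reflection n (grid_vec n s) * U)}
        \<le> 6 * card (grid n m) \<or>
      card (grid n m) \<le> 2 * card {s \<in> grid n m. near_singular n d X (reflection n (grid_vec n s) * U)}"
proof -
  \<comment> \<open>The denominator is the product of the bounds \<open>4 n^3 m^2\<close> for
    \<open>|w|^2\<close> and \<open>2 n^2 m\<close> for the factor of \<open>\<tau>\<close> in an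
    entry of \<open>B *\<^sub>v w\<close>.\<close>
  define R where "R = T / (8 * real n ^ 5 * real m ^ 3)"
  \<comment> \<open>This lower bound for \<open>S\<close> comes from the value of the form at column
    \<open>i0\<close> of \<open>A\<close>, whose entries are at most \<open>2 * K\<close>.\<close>
  define s0 where "s0 = \<eta> / (4 * (real n)\<^sup>2 * K\<^sup>2)"
  define S where "S = Max ((\<lambda>(i, j). cmod (qform M (pair_vec n i j))) ` ({..<n} \<times> {..<n}))"
  define \<tau> where "\<tau> = Max ((\<lambda>(i, j). cmod (B $$ (i, j))) ` ({..<n} \<times> {..<n}))"
  have ne: "{..<n} \<times> {..<n} \<noteq> {}" using n by auto
  have S_ge: "cmod (qform M (pair_vec n i j)) \<le> S" if "i < n" "j < n" for i j
    using that unfolding S_def by (intro Max_ge) auto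
  have \<tau>_ge: "cmod (B $$ (i, j)) \<le> \<tau>" if "i < n" "j < n" for i j
    using that unfolding \<tau>_def by (intro Max_ge) auto
  have "S \<in> (\<lambda>(i, j). cmod (qform M (pair_vec n i j))) ` ({..<n} \<times> {..<n})"
    unfolding S_def using ne by (intro Max_in) auto
  then obtain a b where ab: "a < n" "b < n" "S = cmod (qform M (pair_vec n a b))" by auto
  have "\<tau> \<in> (\<lambda>(i, j). cmod (B $$ (i, j))) ` ({..<n} \<times> {..<n})"
    unfolding \<tau>_def using ne by (intro Max_in) auto
  then obtain p q where pq: "p < n" "q < n" "\<tau> = cmod (B $$ (p, q))" by auto
  have "\<eta> \<le> cmod (qform M (col A i0))" using i0 by (simp add: qform_M_col)
  also have "\<dots> \<le> (real n)\<^sup>2 * (2 * K)\<^sup>2 * S"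
    using i0 by (intro qform_bound S_ge) (auto intro!: perturbed_entry_le[OF U] d K simp: carrier_vecI)
  finally have S: "s0 \<le> S" unfolding s0_def using n K by (simp add: field_simps power2_eq_square)
  have s0: "0 < s0" unfolding s0_def using \<eta> n K by simp
  then have Spos: "0 < S" using S by linarith
  have mpos: "0 < real m" and npos: "0 < real n" using m n by auto
  have Rpos: "0 < R" unfolding R_def using T mpos npos by simp
  have w_le: "cmod (cvec n (grid_vec n s) $ i) \<le> 2 * real n * real m" if "s \<in> grid n m" "i < n" for s i
    using that grid_vec_bounds[OF that] by simp
  have refl: "reflected_inverse_perturbed n d U B (grid_vec n s)" if "s \<in> grid n m" for s
    using grid_vec_norm[OF that n] by unfold_locales simp
  show ?thesis
  proof (cases "\<tau> \<le> R * S")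
    case True
    have "{s \<in> grid n m. near_singular_along n d T (grid_vec n s) (reflection n (grid_vec n s) * U)}
      \<subseteq> {s \<in> grid n m. cmod (qform M (cvec n (grid_vec n s))) \<le> cmod (qform M (pair_vec n a b))}"
    proof safe
      fix s assume s: "s \<in> grid n m"
        and t: "near_singular_along n d T (grid_vec n s) (reflection n (grid_vec n s) * U)"
      interpret r: reflected_inverse_perturbed n d U B "grid_vec n s" using refl[OF s] .
      let ?w = "cvec n (grid_vec n s)"
      show "cmod (qform M ?w) \<le> cmod (qform M (pair_vec n a b))"
      proof (cases "det r.A' = 0")
        case True
        then show ?thesis using r.reflected_singular by simp
      next
        case False
        note B' = scaled_adj[OF r.A'_carrier False]
        obtain i where i: "i < n" "T \<le> cmod ((scaled_adj r.A' *\<^sub>v ?w) $ i)"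
          using t near_singular_along_iff[OF mult_carrier_mat[OF reflection_carrier U_carrier] False] by auto
        obtain c where c: "scaled_adj r.A' *\<^sub>v ?w = c \<cdot>\<^sub>v (B *\<^sub>v ?w)" "c * qform M ?w = - r.N"
          using r.reflected_inverse_apply[OF B'(1,2)] by blast
        have "cmod ((B *\<^sub>v ?w) $ i) = cmod (\<Sum>j<n. B $$ (i, j) * ?w $ j)"
          by (simp only: mult_mat_vec_index_sum[OF B cvec_carrier i(1)])
        also have "\<dots> \<le> (\<Sum>j<n. \<tau> * (2 * real n * real m))"
          using i(1) \<tau>_ge w_le[OF s] unfolding norm_mult[symmetric]
          by (intro sum_norm_le) (auto simp: norm_mult intro!: mult_mono order_trans[OF norm_ge_zero \<tau>_ge] simp del: cvec_index)
        finally have Bw: "cmod ((B *\<^sub>v ?w) $ i) \<le> 2 * (real n)\<^sup>2 * real m * \<tau>"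
          by (simp add: power2_eq_square algebra_simps)
        have "T \<le> cmod c * cmod ((B *\<^sub>v ?w) $ i)"
          using i unfolding c(1) by (simp add: norm_mult)
        \<comment> \<open>Multiplying by the form turns the unknown \<open>c\<close> into
          \<open>c * qform M ?w\<close>, which is minus the squared length of
          \<open>w\<close>.\<close>
        then have "T * cmod (qform M ?w) \<le> cmod c * cmod ((B *\<^sub>v ?w) $ i) * cmod (qform M ?w)"
          by (rule mult_right_mono) simp
        also have "\<dots> = cmod (c * qform M ?w) * cmod ((B *\<^sub>v ?w) $ i)" by (simp add: norm_mult)
        also have "\<dots> \<le> (4 * real n ^ 3 * (real m)\<^sup>2) * (2 * (real n)\<^sup>2 * real m * \<tau>)"
          unfolding c(2) using grid_vec_norm[OF s n] Bw
          by (intro mult_mono) (simp_all del: of_real_sum)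
        also have "\<dots> = 8 * real n ^ 5 * real m ^ 3 * \<tau>"
          by (simp add: power2_eq_square power3_eq_cube power_def numeral_eq_Suc algebra_simps)
        also have "\<dots> \<le> 8 * real n ^ 5 * real m ^ 3 * (R * S)"
          using True by (intro mult_left_mono) auto
        also have "\<dots> = T * S" unfolding R_def using mpos npos by simp
        finally show ?thesis using T ab(3) by simp
      qed
    qed
    then have "card {s \<in> grid n m. near_singular_along n d T (grid_vec n s) (reflection n (grid_vec n s) * U)}
      \<le> card {s \<in> grid n m. cmod (qform M (cvec n (grid_vec n s))) \<le> cmod (qform M (pair_vec n a b))}"
      by (intro card_mono) auto
    then have "m * card {s \<in> grid n m. near_singular_along n d T (grid_vec n s) (reflection n (grid_vec n s) * U)}
      \<le> m * card {s \<in> grid n m. cmod (qform M (cvec n (grid_vec n s))) \<le> cmod (qform M (pair_vec n a b))}"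
      by (rule mult_le_mono2)
    also have "\<dots> \<le> 6 * card (grid n m)"
      by (rule grid_qform_small) (use ab Spos in auto)
    finally show ?thesis by blast
  next
    case False
    then have \<tau>: "R * S < \<tau>" by simp
    have \<tau>pos: "0 < \<tau>" using \<tau> mult_pos_pos[OF Rpos Spos] by linarith
    obtain k where k: "k < n" "\<tau> \<le> real n * cmod (G $$ (k, q))"
      using B_entry_le_G[OF pq(1,2)] pq(3) by metis
    have Gnz: "G $$ (k, q) \<noteq> 0" using k(2) \<tau>pos by auto
    have Bnz: "B $$ (p, q) \<noteq> 0" using pq(3) \<tau>pos by auto
    \<comment> \<open>The two factors on the right of the update formula must both be large; each
      fails on at most a quarter of the grid since \<open>m\<close> is at least 4.\<close>
    let ?Y1 = "{s \<in> grid n m. cmod (\<Sum>l<n. B $$ (p, l) * of_real (grid_vec n s l)) < cmod (B $$ (p, q))}"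
    let ?Y2 = "{s \<in> grid n m. cmod (\<Sum>l<n. G $$ (l, q) * of_real (grid_vec n s l)) < cmod (G $$ (k, q))}"
    let ?X = "{s \<in> grid n m. near_singular n d X (reflection n (grid_vec n s) * U)}"
    have "4 * card ?Y1 \<le> m * card ?Y1" using m by simp
    also have "\<dots> \<le> card (grid n m)" by (rule grid_linear_small[of q n "\<lambda>l. B $$ (p, l)"]) (use pq Bnz in auto)
    finally have Y1: "4 * card ?Y1 \<le> card (grid n m)" .
    have "4 * card ?Y2 \<le> m * card ?Y2" using m by simp
    also have "\<dots> \<le> card (grid n m)" by (rule grid_linear_small[of k n "\<lambda>l. G $$ (l, q)"]) (use k Gnz in auto)
    finally have Y2: "4 * card ?Y2 \<le> card (grid n m)" .
    have "grid n m \<subseteq> ?X \<union> (?Y1 \<union> ?Y2)"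
    proof (rule ccontr)
      assume "\<not> grid n m \<subseteq> ?X \<union> (?Y1 \<union> ?Y2)"
      then obtain s where s: "s \<in> grid n m" and ns: "\<not> near_singular n d X (reflection n (grid_vec n s) * U)"
        and y1: "\<tau> \<le> cmod (\<Sum>l<n. B $$ (p, l) * of_real (grid_vec n s l))"
        and y2: "cmod (G $$ (k, q)) \<le> cmod (\<Sum>l<n. G $$ (l, q) * of_real (grid_vec n s l))"
        using pq(3) by force
      interpret r: reflected_inverse_perturbed n d U B "grid_vec n s" using refl[OF s] .
      let ?w = "cvec n (grid_vec n s)"
      have det: "det r.A' \<noteq> 0" using ns by (auto simp: near_singular_def)
      note B' = scaled_adj[OF r.A'_carrier det]
      have X_gt: "cmod (scaled_adj r.A' $$ (p, q)) < X"
        using ns pq near_singular_iff[OF mult_carrier_mat[OF reflection_carrier U_carrier] det] by (meson not_less)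
      have Bw: "\<tau> \<le> cmod ((B *\<^sub>v ?w) $ p)"
        using y1 unfolding mult_mat_vec_index_sum[OF B cvec_carrier pq(1)] by simp
      have "?w \<bullet> col G q = (\<Sum>l<n. G $$ (l, q) * of_real (grid_vec n s l))"
        using pq carrier_matD[OF G_carrier] by (simp add: scalar_prod_def atLeast0LessThan mult.commute)
      then have "cmod (G $$ (k, q)) \<le> cmod (?w \<bullet> col G q)" using y2 by simp
      moreover have "\<tau> / real n \<le> cmod (G $$ (k, q))" using k npos by (simp add: field_simps)
      ultimately have Gw: "\<tau> / real n \<le> cmod (?w \<bullet> col G q)" by linarith
      have "2 * (\<tau> / real n) * \<tau> \<le> 2 * cmod (?w \<bullet> col G q) * cmod ((B *\<^sub>v ?w) $ p)"
        using Bw Gw \<tau>pos by (intro mult_mono) auto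
      also have "\<dots> = cmod ((scaled_adj r.A' $$ (p, q) - B $$ (p, q)) * qform M ?w)"
        unfolding r.reflected_inverse_entry[OF B' pq(1,2)] by (simp add: norm_mult)
      also have "\<dots> \<le> (X + \<tau>) * ((real n)\<^sup>2 * (2 * real n * real m)\<^sup>2 * S)"
        unfolding norm_mult
        using X_gt pq(3) norm_triangle_ineq4[of "scaled_adj r.A' $$ (p, q)" "B $$ (p, q)"] X
        by (intro mult_mono qform_bound S_ge w_le[OF s]) auto
      finally have "\<tau>\<^sup>2 \<le> (2 * real n ^ 5 * (real m)\<^sup>2) * S * (X + \<tau>)"
        using npos by (simp add: field_simps power2_eq_square power_def numeral_eq_Suc)
      moreover define P where "P = 2 * real n ^ 5 * (real m)\<^sup>2"
      ultimately have main: "\<tau>\<^sup>2 \<le> P * S * X + P * S * \<tau>" by (simp add: algebra_simps)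
      have P: "0 < P" using npos mpos by (simp add: P_def)
      have r1: "2 * P \<le> R" using R1 by (simp add: P_def R_def)
      have r2: "5 / 2 * P * X \<le> R\<^sup>2 * s0" using R2 unfolding P_def R_def s0_def by (simp add: mult_ac)
      \<comment> \<open>Since \<open>R * S < \<tau>\<close>, the term \<open>P * S * \<tau>\<close>
        is at most half of the left side of \<open>main\<close>. What remains,
        \<open>\<tau>^2 <= 2 P S X\<close>, contradicts the lower bound with \<open>5 / 2\<close>
        that follows.\<close>
      have "2 * P * (S * \<tau>) \<le> R * (S * \<tau>)" using r1 Spos \<tau>pos by (intro mult_right_mono) auto
      also have "\<dots> \<le> \<tau> * \<tau>" using \<tau> \<tau>pos by (simp add: mult.assoc[symmetric])
      finally have "\<tau>\<^sup>2 \<le> 2 * P * S * X" using main by (simp add: power2_eq_square algebra_simps)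
      moreover have "5 / 2 * P * X * S \<le> \<tau>\<^sup>2"
      proof -
        have "5 / 2 * P * X * S \<le> R\<^sup>2 * s0 * S" using r2 Spos by (intro mult_right_mono) auto
        also have "\<dots> \<le> R\<^sup>2 * S * S" using S Spos by (intro mult_right_mono mult_left_mono) auto
        also have "\<dots> = (R * S)\<^sup>2" by (simp add: power2_eq_square)
        also have "\<dots> \<le> \<tau>\<^sup>2" using \<tau> Rpos Spos by (intro power_mono) auto
        finally show ?thesis .
      qed
      moreover have "0 < P * S * X" using P Spos X by simp
      ultimately show False by (simp add: algebra_simps)
    qed
    then have "card (grid n m) \<le> card (?X \<union> (?Y1 \<union> ?Y2))" by (intro card_mono) auto
    also have "\<dots> \<le> card ?X + card (?Y1 \<union> ?Y2)" by (rule card_Un_le)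
    also have "\<dots> \<le> card ?X + (card ?Y1 + card ?Y2)" by (intro add_left_mono card_Un_le)
    finally have "card (grid n m) \<le> 2 * card ?X" using Y1 Y2 by linarith
    then show ?thesis by blast
  qed
qed

end

subsection \<open>Haar measure and averaging over reflections\<close>

lemma haar_space:
  assumes "haar_orthogonal_group n \<mu>"
  shows "space \<mu> = orthogonal_group n"
  using assms sets_eq_imp_space_eq[of \<mu> "borel_orthogonal_group n"]
  by (simp add: haar_orthogonal_group_def borel_orthogonal_group_def)

lemma haar_entry_measurable:
  assumes "haar_orthogonal_group n \<mu>" "i < n" "j < n"
  shows "(\<lambda>U. U $$ (i, j)) \<in> borel_measurable \<mu>"
proof -
  have "(\<lambda>Q. \<lambda>(i, j)\<in>{..<n} \<times> {..<n}. Q $$ (i, j)) \<in> borel_orthogonal_group n \<rightarrow>\<^sub>M Pi\<^sub>M ({..<n} \<times> {..<n}) (\<lambda>_. borel)"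
    unfolding borel_orthogonal_group_def by (rule measurable_vimage_algebra1) (auto simp: space_PiM)
  then have "(\<lambda>Q. (\<lambda>(i, j)\<in>{..<n} \<times> {..<n}. Q $$ (i, j)) (i, j)) \<in> borel_measurable (borel_orthogonal_group n)"
    by (rule measurable_compose) (use assms in \<open>intro measurable_component_singleton, auto\<close>)
  then have "(\<lambda>Q. Q $$ (i, j)) \<in> borel_measurable (borel_orthogonal_group n)" using assms by simp
  moreover have "sets \<mu> = sets (borel_orthogonal_group n)"
    using assms(1) by (simp add: haar_orthogonal_group_def)
  ultimately show ?thesis by (subst measurable_cong_sets[OF _ refl])
qed

lemma haar_mult_measurable:
  assumes h: "haar_orthogonal_group n \<mu>" and Q: "Q \<in> orthogonal_group n"
  shows "(\<lambda>U. Q * U) \<in> \<mu> \<rightarrow>\<^sub>M \<mu>"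
proof -
  have Qc: "Q \<in> carrier_mat n n" using Q by (simp add: orthogonal_group_def)
  have "(\<lambda>U. Q * U) \<in> \<mu> \<rightarrow>\<^sub>M borel_orthogonal_group n"
    unfolding borel_orthogonal_group_def
  proof (rule measurable_vimage_algebra2)
    show "(\<lambda>U. Q * U) \<in> space \<mu> \<rightarrow> orthogonal_group n"
      using orthogonal_group_mult[OF Q] by (simp add: haar_space[OF h])
    have "(\<lambda>U. \<lambda>ij\<in>{..<n} \<times> {..<n}. (Q * U) $$ ij) \<in> \<mu> \<rightarrow>\<^sub>M Pi\<^sub>M ({..<n} \<times> {..<n}) (\<lambda>_. borel)"
    proof (rule measurable_restrict)
      fix ij assume "ij \<in> {..<n} \<times> {..<n}"
      then obtain i j where ij: "ij = (i, j)" "i < n" "j < n" by auto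
      have "(\<lambda>U. (Q * U) $$ ij) \<in> borel_measurable \<mu> \<longleftrightarrow> (\<lambda>U. \<Sum>k<n. Q $$ (i, k) * U $$ (k, j)) \<in> borel_measurable \<mu>"
        by (rule measurable_cong)
          (use ij Qc in \<open>auto simp: haar_space[OF h] orthogonal_group_def scalar_prod_def atLeast0LessThan\<close>)
      then show "(\<lambda>U. (Q * U) $$ ij) \<in> borel_measurable \<mu>"
        using haar_entry_measurable[OF h] ij by simp
    qed
    moreover have "(\<lambda>(i, j)\<in>{..<n} \<times> {..<n}. (Q * U) $$ (i, j)) = (\<lambda>ij\<in>{..<n} \<times> {..<n}. (Q * U) $$ ij)" for U
      by (intro restrict_ext) auto
    ultimately show "(\<lambda>U. \<lambda>(i, j)\<in>{..<n} \<times> {..<n}. (Q * U) $$ (i, j)) \<in> \<mu> \<rightarrow>\<^sub>M Pi\<^sub>M ({..<n} \<times> {..<n}) (\<lambda>_. borel)"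
      by simp
  qed
  then show ?thesis
    using h measurable_cong_sets[of \<mu> \<mu> \<mu> "borel_orthogonal_group n"] by (simp add: haar_orthogonal_group_def)
qed

lemma haar_mult_prob:
  assumes h: "haar_orthogonal_group n \<mu>" and Q: "Q \<in> orthogonal_group n"
    and P: "{U \<in> space \<mu>. P U} \<in> sets \<mu>"
  shows "{U \<in> space \<mu>. P (Q * U)} \<in> sets \<mu>"
    "measure \<mu> {U \<in> space \<mu>. P (Q * U)} = measure \<mu> {U \<in> space \<mu>. P U}"
proof -
  have m: "(\<lambda>U. Q * U) \<in> \<mu> \<rightarrow>\<^sub>M \<mu>" by (rule haar_mult_measurable[OF h Q])
  have e: "(\<lambda>U. Q * U) -` {U \<in> space \<mu>. P U} \<inter> space \<mu> = {U \<in> space \<mu>. P (Q * U)}"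
    using measurable_space[OF m] by auto
  show "{U \<in> space \<mu>. P (Q * U)} \<in> sets \<mu>" using measurable_sets[OF m P] unfolding e .
  have "measure (distr \<mu> \<mu> (\<lambda>U. Q * U)) {U \<in> space \<mu>. P U} = measure \<mu> {U \<in> space \<mu>. P (Q * U)}"
    unfolding measure_distr[OF m P] e ..
  then show "measure \<mu> {U \<in> space \<mu>. P (Q * U)} = measure \<mu> {U \<in> space \<mu>. P U}"
    using h Q by (simp add: haar_orthogonal_group_def)
qed

lemma det_measurable:
  fixes F :: "'a \<Rightarrow> complex mat"
  assumes "\<And>x. x \<in> space N \<Longrightarrow> F x \<in> carrier_mat k k"
    and "\<And>i j. i < k \<Longrightarrow> j < k \<Longrightarrow> (\<lambda>x. F x $$ (i, j)) \<in> borel_measurable N"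
  shows "(\<lambda>x. det (F x)) \<in> borel_measurable N"
proof -
  have "(\<lambda>x. det (F x)) \<in> borel_measurable N \<longleftrightarrow>
      (\<lambda>x. \<Sum>p\<in>{p. p permutes {0..<k}}. signof p * (\<Prod>i = 0..<k. F x $$ (i, p i))) \<in> borel_measurable N"
    by (rule measurable_cong) (simp add: det_def'[OF assms(1)])
  also have "\<dots>"
  proof (intro borel_measurable_sum borel_measurable_times borel_measurable_prod)
    fix p i assume "p \<in> {p. p permutes {0..<k}}" "i \<in> {0..<k}"
    then have "i < k" "p i < k" using permutes_in_image[of p "{0..<k}" i] by auto
    then show "(\<lambda>x. F x $$ (i, p i)) \<in> borel_measurable N" by (rule assms(2))
  qed auto
  finally show ?thesis .
qed

lemma adj_mat_measurable:
  fixes F :: "'a \<Rightarrow> complex mat"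
  assumes F: "\<And>x. x \<in> space N \<Longrightarrow> F x \<in> carrier_mat k k"
    and m: "\<And>i j. i < k \<Longrightarrow> j < k \<Longrightarrow> (\<lambda>x. F x $$ (i, j)) \<in> borel_measurable N"
    and ij: "i < k" "j < k"
  shows "(\<lambda>x. adj_mat (F x) $$ (i, j)) \<in> borel_measurable N"
proof -
  have "(\<lambda>x. adj_mat (F x) $$ (i, j)) \<in> borel_measurable N \<longleftrightarrow>
      (\<lambda>x. (- 1) ^ (j + i) * det (mat_delete (F x) j i)) \<in> borel_measurable N"
    by (rule measurable_cong) (use F ij in \<open>auto simp: adj_mat_def cofactor_def dest!: F\<close>)
  also have "\<dots>"
  proof (intro borel_measurable_times borel_measurable_const det_measurable[where k = "k - 1"])
    fix x assume "x \<in> space N"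
    then show "mat_delete (F x) j i \<in> carrier_mat (k - 1) (k - 1)" using F by (intro mat_delete_carrier) auto
  next
    fix a b assume ab: "a < k - 1" "b < k - 1"
    let ?a = "if a < j then a else Suc a" and ?b = "if b < i then b else Suc b"
    have "(\<lambda>x. mat_delete (F x) j i $$ (a, b)) \<in> borel_measurable N \<longleftrightarrow>
        (\<lambda>x. F x $$ (?a, ?b)) \<in> borel_measurable N"
    proof (rule measurable_cong)
      fix x assume "x \<in> space N"
      with F have "F x \<in> carrier_mat k k" by blast
      then show "mat_delete (F x) j i $$ (a, b) = F x $$ (?a, ?b)" using ab by (auto simp: mat_delete_def)
    qed
    then show "(\<lambda>x. mat_delete (F x) j i $$ (a, b)) \<in> borel_measurable N"
      using m[of ?a ?b] ab by (auto split: if_splits)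
  qed
  finally show ?thesis .
qed

lemma near_singular_measurable:
  assumes h: "haar_orthogonal_group n \<mu>"
  shows "{U \<in> space \<mu>. near_singular n d T U} \<in> sets \<mu>"
    and "{U \<in> space \<mu>. near_singular_along n d T u U} \<in> sets \<mu>"
proof -
  have car: "U \<in> space \<mu> \<Longrightarrow> perturbed n d U \<in> carrier_mat n n" for U
    using haar_space[OF h] by (intro perturbed_carrier) (auto simp: orthogonal_group_def)
  have ent: "(\<lambda>U. perturbed n d U $$ (i, j)) \<in> borel_measurable \<mu>" if "i < n" "j < n" for i j
  proof -
    have "(\<lambda>U. perturbed n d U $$ (i, j)) \<in> borel_measurable \<mu> \<longleftrightarrow>
        (\<lambda>U. (if i = j then d i else 0) + complex_of_real (U $$ (i, j))) \<in> borel_measurable \<mu>"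
      using that haar_space[OF h]
      by (intro measurable_cong perturbed_entry) (auto simp: orthogonal_group_def)
    then show ?thesis using haar_entry_measurable[OF h that] by simp
  qed
  note [measurable] = det_measurable[OF car ent]
  have adj: "(\<lambda>U. adj_mat (perturbed n d U) $$ (i, j)) \<in> borel_measurable \<mu>" if "i < n" "j < n" for i j
    using adj_mat_measurable[OF car ent that] .
  have "{U \<in> space \<mu>. near_singular n d T U} = {U \<in> space \<mu>. det (perturbed n d U) = 0} \<union>
      (\<Union>i<n. \<Union>j<n. {U \<in> space \<mu>. T * cmod (det (perturbed n d U)) \<le> cmod (adj_mat (perturbed n d U) $$ (i, j))})"
    by (auto simp: near_singular_def)
  also have "\<dots> \<in> sets \<mu>"
  proof (intro sets.Un sets.finite_UN)
    show "{U \<in> space \<mu>. det (perturbed n d U) = 0} \<in> sets \<mu>" by measurable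
    fix i j assume "i \<in> {..<n}" "j \<in> {..<n}"
    then have [measurable]: "(\<lambda>U. adj_mat (perturbed n d U) $$ (i, j)) \<in> borel_measurable \<mu>" using adj by simp
    show "{U \<in> space \<mu>. T * cmod (det (perturbed n d U)) \<le> cmod (adj_mat (perturbed n d U) $$ (i, j))} \<in> sets \<mu>"
      by measurable
  qed auto
  finally show "{U \<in> space \<mu>. near_singular n d T U} \<in> sets \<mu>" .
  have "{U \<in> space \<mu>. near_singular_along n d T u U} = {U \<in> space \<mu>. det (perturbed n d U) = 0} \<union>
      (\<Union>i<n. {U \<in> space \<mu>. T * cmod (det (perturbed n d U))
        \<le> cmod (\<Sum>j<n. adj_mat (perturbed n d U) $$ (i, j) * of_real (u j))})"
    by (auto simp: near_singular_along_def)
  also have "\<dots> \<in> sets \<mu>"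
  proof (intro sets.Un sets.finite_UN)
    show "{U \<in> space \<mu>. det (perturbed n d U) = 0} \<in> sets \<mu>" by measurable
    fix i assume "i \<in> {..<n}"
    then have [measurable]: "(\<lambda>U. \<Sum>j<n. adj_mat (perturbed n d U) $$ (i, j) * of_real (u j)) \<in> borel_measurable \<mu>"
      using adj by (intro borel_measurable_sum borel_measurable_times) auto
    show "{U \<in> space \<mu>. T * cmod (det (perturbed n d U))
        \<le> cmod (\<Sum>j<n. adj_mat (perturbed n d U) $$ (i, j) * of_real (u j))} \<in> sets \<mu>"
      by measurable
  qed auto
  finally show "{U \<in> space \<mu>. near_singular_along n d T u U} \<in> sets \<mu>" .
qed

text \<open>Linearity of expectation. Averaging over the random vector is a finite sum over the
  grid, so no product measure is formed and the counting can be done for fixed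
  \<open>U\<close>.\<close>

lemma (in prob_space) sum_prob_eq_expectation_card:
  assumes "finite I" and E: "\<And>s. s \<in> I \<Longrightarrow> {x \<in> space M. P s x} \<in> events"
  shows "integrable M (\<lambda>x. real (card {s \<in> I. P s x}))"
    and "(\<Sum>s\<in>I. prob {x \<in> space M. P s x}) = expectation (\<lambda>x. real (card {s \<in> I. P s x}))"
proof -
  have e: "real (card {s \<in> I. P s x}) = (\<Sum>s\<in>I. indicator {x \<in> space M. P s x} x)" if "x \<in> space M" for x
    using assms(1) that by (simp add: indicator_def sum.inter_filter[symmetric] Int_def)
  have i: "integrable M (\<lambda>x. \<Sum>s\<in>I. indicator {x \<in> space M. P s x} x :: real)"
    using E by (intro Bochner_Integration.integrable_sum) (simp add: emeasure_eq_measure)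
  show "integrable M (\<lambda>x. real (card {s \<in> I. P s x}))"
    using i by (subst Bochner_Integration.integrable_cong[OF refl e]) auto
  have "expectation (\<lambda>x. real (card {s \<in> I. P s x})) = expectation (\<lambda>x. \<Sum>s\<in>I. indicator {x \<in> space M. P s x} x)"
    by (rule Bochner_Integration.integral_cong[OF refl e])
  also have "\<dots> = (\<Sum>s\<in>I. prob {x \<in> space M. P s x})"
    using E by (subst Bochner_Integration.integral_sum) (simp_all add: emeasure_eq_measure)
  finally show "(\<Sum>s\<in>I. prob {x \<in> space M. P s x}) = expectation (\<lambda>x. real (card {s \<in> I. P s x}))" ..
qed

text \<open>For \<open>U\<close> independent of \<open>s\<close>, being near singular is detected
  along at least half of the grid vectors (\<open>?c1\<close>). Invariance inserts the reflection in
  each term (\<open>?c2\<close>), after which the dichotomy bounds the count pointwise in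
  \<open>U\<close>.\<close>

lemma near_singular_prob_step:
  fixes m :: nat and K \<eta> T X :: real
  assumes h: "haar_orthogonal_group n \<mu>"
    and n: "0 < n" and d: "\<And>i. i < n \<Longrightarrow> cmod (d i) \<le> K" and K: "1 \<le> K"
    and i0: "i0 < n" "\<eta> \<le> cmod (1 - (d i0)\<^sup>2)" and \<eta>: "0 < \<eta>" and m: "4 \<le> m"
    and T: "0 < T" and X: "0 < X"
    and R1: "4 * real n ^ 5 * (real m)\<^sup>2 \<le> T / (8 * real n ^ 5 * real m ^ 3)"
    and R2: "5 * real n ^ 5 * (real m)\<^sup>2 * X
      \<le> (T / (8 * real n ^ 5 * real m ^ 3))\<^sup>2 * (\<eta> / (4 * (real n)\<^sup>2 * K\<^sup>2))"
  shows "measure \<mu> {U \<in> space \<mu>. near_singular n d T U}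
    \<le> 12 / real m + 6 * measure \<mu> {U \<in> space \<mu>. near_singular n d X U}"
proof -
  interpret prob_space \<mu> using h by (simp add: haar_orthogonal_group_def)
  let ?H = "\<lambda>s. reflection n (grid_vec n s)"
  let ?p = "\<lambda>T. prob {U \<in> space \<mu>. near_singular n d T U}"
  define N where "N = real (card (grid n m))"
  have "card (grid n m) = m ^ (n * n)" by (simp add: grid_def card_PiE)
  then have Npos: "0 < N" using m by (simp add: N_def)
  note meas = near_singular_measurable[OF h]
  have H: "?H s \<in> orthogonal_group n" if "s \<in> grid n m" for s
    using grid_vec_norm[OF that n] by (intro reflection_orthogonal) auto
  note inv = haar_mult_prob[OF h H]
  let ?c1 = "\<lambda>U. real (card {s \<in> grid n m. near_singular_along n d T (grid_vec n s) U})"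
  let ?c2 = "\<lambda>U. real (card {s \<in> grid n m. near_singular_along n d T (grid_vec n s) (?H s * U)})"
  let ?c3 = "\<lambda>U. real (card {s \<in> grid n m. near_singular n d X (?H s * U)})"
  have S1: "integrable \<mu> ?c1" "(\<Sum>s\<in>grid n m. prob {U \<in> space \<mu>. near_singular_along n d T (grid_vec n s) U}) = expectation ?c1"
    by (rule sum_prob_eq_expectation_card; simp add: meas)+
  have S2: "integrable \<mu> ?c2" "(\<Sum>s\<in>grid n m. prob {U \<in> space \<mu>. near_singular_along n d T (grid_vec n s) (?H s * U)}) = expectation ?c2"
    by (rule sum_prob_eq_expectation_card; simp add: inv(1)[OF _ meas(2)])+
  have S3: "integrable \<mu> ?c3" "(\<Sum>s\<in>grid n m. prob {U \<in> space \<mu>. near_singular n d X (?H s * U)}) = expectation ?c3"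
    by (rule sum_prob_eq_expectation_card; simp add: inv(1)[OF _ meas(1)])+
  have ind: "integrable \<mu> (\<lambda>U. indicator {U \<in> space \<mu>. near_singular n d Y U} U :: real)" for Y
    using meas(1) by (simp add: emeasure_eq_measure)
  have "N * ?p T = expectation (\<lambda>U. N * indicator {U \<in> space \<mu>. near_singular n d T U} U)"
    using meas(1) by simp
  also have "\<dots> \<le> expectation (\<lambda>U. 2 * ?c1 U)"
  proof (rule integral_mono)
    show "integrable \<mu> (\<lambda>U. N * indicator {U \<in> space \<mu>. near_singular n d T U} U)" using ind by simp
    show "integrable \<mu> (\<lambda>U. 2 * ?c1 U)" using S1(1) by simp
    fix U assume "U \<in> space \<mu>"
    show "N * indicator {U \<in> space \<mu>. near_singular n d T U} U \<le> 2 * ?c1 U"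
    proof (cases "near_singular n d T U")
      case True
      then show ?thesis using card_near_singular_along_ge[OF True T, of m] m by (simp add: N_def indicator_def)
    qed simp
  qed
  also have "\<dots> = 2 * expectation ?c1" by simp
  also have "expectation ?c1 = expectation ?c2"
    unfolding S1(2)[symmetric] S2(2)[symmetric] by (intro sum.cong refl inv(2)[symmetric] meas)
  also have "expectation ?c2 \<le> expectation (\<lambda>U. 6 * N / real m
      + N * indicator {U \<in> space \<mu>. near_singular n d X U} U + 2 * ?c3 U)"
  proof (rule integral_mono)
    show "integrable \<mu> ?c2" by fact
    show "integrable \<mu> (\<lambda>U. 6 * N / real m + N * indicator {U \<in> space \<mu>. near_singular n d X U} U + 2 * ?c3 U)"
      using S3(1) ind by simp
    fix U assume U: "U \<in> space \<mu>"
    have c2N: "?c2 U \<le> N" unfolding N_def by (intro of_nat_mono card_mono) auto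
    show "?c2 U \<le> 6 * N / real m + N * indicator {U \<in> space \<mu>. near_singular n d X U} U + 2 * ?c3 U"
    proof (cases "det (perturbed n d U) = 0")
      case True
      \<comment> \<open>A singular matrix has no inverse for the dichotomy, but it is near singular
        at every level, so the indicator term alone dominates the count.\<close>
      then have "indicator {U \<in> space \<mu>. near_singular n d X U} U = (1 :: real)"
        using U by (simp add: near_singular_def)
      then show ?thesis using c2N Npos m by (smt (verit) divide_nonneg_nonneg mult_cancel_left2 of_nat_0_le_iff)
    next
      case False
      have Uo: "U \<in> orthogonal_group n" using U by (simp add: haar_space[OF h])
      then have A: "perturbed n d U \<in> carrier_mat n n" by (simp add: orthogonal_group_def)
      interpret inverse_perturbed n d U "scaled_adj (perturbed n d U)"
        using scaled_adj[OF A False] Uo by unfold_locales auto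
      have nn: "0 \<le> 6 * N / real m" "0 \<le> N * indicator {U \<in> space \<mu>. near_singular n d X U} U" "0 \<le> ?c3 U"
        using Npos by auto
      from reflection_dichotomy[OF n d K i0 \<eta> m T X R1 R2]
      show ?thesis
      proof
        assume "m * card {s \<in> grid n m. near_singular_along n d T (grid_vec n s) (?H s * U)} \<le> 6 * card (grid n m)"
        from of_nat_mono[OF this, where 'a = real]
        have "real m * ?c2 U \<le> 6 * N" by (simp only: of_nat_mult of_nat_numeral N_def)
        then have "?c2 U \<le> 6 * N / real m" using m by (simp add: field_simps)
        then show ?thesis using nn by linarith
      next
        assume "card (grid n m) \<le> 2 * card {s \<in> grid n m. near_singular n d X (?H s * U)}"
        from of_nat_mono[OF this, where 'a = real]
        have "N \<le> 2 * ?c3 U" by (simp only: of_nat_mult of_nat_numeral N_def)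
        then show ?thesis using nn c2N by linarith
      qed
    qed
  qed
  also have "\<dots> = 6 * N / real m + N * ?p X + 2 * expectation ?c3"
    using S3(1) ind meas(1) by (simp add: prob_space)
  \<comment> \<open>Invariance again, now removing the reflections;
    \<open>2 * (6 N / m + N p + 2 N p)\<close> yields the constants 12 and 6.\<close>
  also have "expectation ?c3 = N * ?p X"
    unfolding S3(2)[symmetric] N_def using inv(2)[OF _ meas(1)] by simp
  finally have "N * ?p T \<le> N * (12 / real m + 6 * ?p X)" by (simp add: algebra_simps)
  then show ?thesis using Npos by simp
qed

section \<open>Iterating the one-step inequality\<close>

context
  fixes n :: nat and \<mu> :: "real mat measure" and d :: "nat \<Rightarrow> complex" and K \<eta> :: real and i0 :: nat
  assumes h: "haar_orthogonal_group n \<mu>"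
    and n: "0 < n" and d: "\<And>i. i < n \<Longrightarrow> cmod (d i) \<le> K" and K: "1 \<le> K"
    and i0: "i0 < n" "\<eta> \<le> cmod (1 - (d i0)\<^sup>2)" and \<eta>: "0 < \<eta>" "\<eta> \<le> 1"
begin

text \<open>With \<open>T = x^16\<close>, \<open>X = x^20\<close> and \<open>m\<close> between
  \<open>x\<close> and \<open>2 x\<close>, condition \<open>R2\<close> compares order
  \<open>x^22\<close> with order \<open>x^26\<close>; the spare \<open>x^4\<close> pays for the
  factors in \<open>n\<close>, \<open>K\<close> and \<open>\<eta>\<close>. The generous constant
  \<open>2^60\<close> also forces \<open>x\<close> to be at least \<open>2^15\<close>.\<close>

lemma near_singular_prob_power_step:
  fixes x :: real
  assumes x: "0 < x" "2 ^ 60 * real n ^ 17 * K\<^sup>2 / \<eta> \<le> x ^ 4"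
  shows "measure \<mu> {U \<in> space \<mu>. near_singular n d (x ^ 16) U}
    \<le> 12 / x + 6 * measure \<mu> {U \<in> space \<mu>. near_singular n d (x ^ 20) U}"
proof -
  have n1: "1 \<le> real n" using n by simp
  have "2 ^ 60 * real n ^ 17 * 1 * 1 \<le> 2 ^ 60 * real n ^ 17 * K\<^sup>2 * (1 / \<eta>)"
    using K \<eta> by (intro mult_mono) (auto simp: field_simps)
  then have x4': "2 ^ 60 * real n ^ 17 \<le> x ^ 4" using x by simp
  have "(2 ^ 15) ^ 4 * (1::real) \<le> 2 ^ 60 * real n ^ 17"
    using n1 by (intro mult_mono) auto
  then have "(2 ^ 15) ^ 4 \<le> x ^ 4" using x4' by simp
  then have x15: "2 ^ 15 \<le> x" by (rule power_le_imp_le_base[of _ "3", simplified]) (use x in auto)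
  define m where "m = nat \<lceil>x\<rceil>"
  have m1: "x \<le> real m" unfolding m_def using x by linarith
  have m2: "real m \<le> 2 * x" unfolding m_def using x15 by simp linarith
  have mpos: "0 < real m" using m1 x by linarith
  have "real 4 \<le> real m" using m1 x15 by simp
  then have m4: "4 \<le> m" by (simp only: of_nat_le_iff)
  have R: "x ^ 13 / (64 * real n ^ 5) \<le> x ^ 16 / (8 * real n ^ 5 * real m ^ 3)"
  proof -
    have "x ^ 13 / (64 * real n ^ 5) = x ^ 16 / (8 * real n ^ 5 * (2 * x) ^ 3)"
      using x n1 by (simp add: field_simps power_def numeral_eq_Suc)
    also have "\<dots> \<le> x ^ 16 / (8 * real n ^ 5 * real m ^ 3)"
      using x n1 mpos m2 by (intro divide_left_mono mult_left_mono power_mono mult_pos_pos) auto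
    finally show ?thesis .
  qed
  have msq: "(real m)\<^sup>2 \<le> 4 * x\<^sup>2"
    using power_mono[OF m2, of 2] by (simp add: power_mult_distrib)
  have "1024 * real n ^ 10 \<le> 2 ^ 60 * real n ^ 17"
    using n1 by (intro mult_mono power_increasing) auto
  also have "\<dots> \<le> x ^ 4" by (rule x4')
  also have "\<dots> \<le> x ^ 11" using x15 by (intro power_increasing) auto
  finally have b1: "1024 * real n ^ 10 \<le> x ^ 11" .
  have "measure \<mu> {U \<in> space \<mu>. near_singular n d (x ^ 16) U}
    \<le> 12 / real m + 6 * measure \<mu> {U \<in> space \<mu>. near_singular n d (x ^ 20) U}"
  proof (rule near_singular_prob_step[where d = d and K = K, OF h n d K i0 \<eta>(1) m4])
    show "0 < x ^ 16" "0 < x ^ 20" using x by auto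
    have "4 * real n ^ 5 * (real m)\<^sup>2 \<le> 4 * real n ^ 5 * (4 * x\<^sup>2)"
      using msq by (intro mult_left_mono) auto
    also have "\<dots> = (1024 * real n ^ 10) * x\<^sup>2 / (64 * real n ^ 5)"
      using n1 by (simp add: field_simps power_def numeral_eq_Suc)
    also have "\<dots> \<le> x ^ 11 * x\<^sup>2 / (64 * real n ^ 5)"
      using b1 by (intro divide_right_mono mult_right_mono) auto
    also have "\<dots> = x ^ 13 / (64 * real n ^ 5)" by (simp add: power_add[symmetric])
    finally show "4 * real n ^ 5 * (real m)\<^sup>2 \<le> x ^ 16 / (8 * real n ^ 5 * real m ^ 3)" using R by linarith
    have "5 * real n ^ 5 * (real m)\<^sup>2 * x ^ 20 \<le> 5 * real n ^ 5 * (4 * x\<^sup>2) * x ^ 20"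
      using msq x by (intro mult_right_mono mult_left_mono) auto
    \<comment> \<open>The first factor is exactly what \<open>x ^ 4\<close> has to dominate:
      \<open>20 * 4096 * 4 = 2^18 * 5 / 4\<close>.\<close>
    also have "\<dots> = (2 ^ 18 * 5 / 4 * real n ^ 17 * K\<^sup>2 / \<eta>) * (x ^ 22 * \<eta> / (4096 * real n ^ 10 * (4 * (real n)\<^sup>2 * K\<^sup>2)))"
      using n1 K \<eta> by (simp add: divide_simps)
    also have "\<dots> \<le> x ^ 4 * (x ^ 22 * \<eta> / (4096 * real n ^ 10 * (4 * (real n)\<^sup>2 * K\<^sup>2)))"
    proof (rule mult_right_mono)
      have "2 ^ 18 * 5 / 4 * real n ^ 17 * K\<^sup>2 / \<eta> \<le> 2 ^ 60 * real n ^ 17 * K\<^sup>2 / \<eta>"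
        using \<eta> K n1 by (intro divide_right_mono mult_right_mono) auto
      then show "2 ^ 18 * 5 / 4 * real n ^ 17 * K\<^sup>2 / \<eta> \<le> x ^ 4" using x(2) by linarith
    qed (use x \<eta> in auto)
    also have "\<dots> = (x ^ 13 / (64 * real n ^ 5))\<^sup>2 * (\<eta> / (4 * (real n)\<^sup>2 * K\<^sup>2))"
      by (simp add: power_divide power_mult_distrib power_mult[symmetric] power_add[symmetric])
    also have "\<dots> \<le> (x ^ 16 / (8 * real n ^ 5 * real m ^ 3))\<^sup>2 * (\<eta> / (4 * (real n)\<^sup>2 * K\<^sup>2))"
      using R x \<eta> by (intro mult_right_mono power_mono) auto
    finally show "5 * real n ^ 5 * (real m)\<^sup>2 * x ^ 20
      \<le> (x ^ 16 / (8 * real n ^ 5 * real m ^ 3))\<^sup>2 * (\<eta> / (4 * (real n)\<^sup>2 * K\<^sup>2))" .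
  qed
  also have "12 / real m \<le> 12 / x" using m1 x by (intro divide_left_mono) auto
  finally show ?thesis by simp
qed

text \<open>Each step raises \<open>x\<close> to the power \<open>5 / 4\<close>. The error
  \<open>12 / x_k\<close> of step \<open>k\<close> is weighted by \<open>6^k\<close>, but
  \<open>x_k\<close> is at least \<open>12^k * x\<close>, so the errors form a geometric series with
  sum at most \<open>24 / x\<close>.\<close>

lemma near_singular_prob_iterate:
  fixes x :: real
  assumes x: "2 ^ 15 \<le> x" "2 ^ 60 * real n ^ 17 * K\<^sup>2 / \<eta> \<le> x ^ 4"
  shows "measure \<mu> {U \<in> space \<mu>. near_singular n d (x ^ 16) U}
    \<le> 24 / x + 6 ^ k * measure \<mu> {U \<in> space \<mu>. near_singular n d ((x powr ((5 / 4) ^ k)) ^ 16) U}"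
proof -
  let ?x = "\<lambda>k. x powr ((5 / 4) ^ k)"
  let ?p = "\<lambda>T. measure \<mu> {U \<in> space \<mu>. near_singular n d T U}"
  have growth: "x * 12 ^ k \<le> ?x k" for k
  proof -
    have "12 = (12 ^ 4) powr (1 / 4 :: real)" by (simp add: powr_powr flip: powr_numeral)
    \<comment> \<open>Here \<open>12^4 = 20736\<close> is below \<open>2^15\<close>; Bernoulli's
      inequality below then bounds \<open>(5 / 4)^k\<close> from below by
      \<open>1 + k / 4\<close>.\<close>
    also have "\<dots> \<le> x powr (1 / 4)" using x by (intro powr_mono2) auto
    finally have "12 ^ k \<le> (x powr (1 / 4)) ^ k" by (intro power_mono) auto
    then have "x * 12 ^ k \<le> x powr 1 * (x powr (1 / 4)) ^ k" using x by simp
    also have "\<dots> = x powr (1 + real k * (1 / 4))"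
      using x by (simp add: powr_add powr_power mult.commute)
    also have "\<dots> \<le> ?x k"
      using Bernoulli_inequality[of "1 / 4" k] x by (intro powr_mono) auto
    finally show ?thesis .
  qed
  have "?p (x ^ 16) \<le> 24 / x * (1 - (1 / 2) ^ k) + 6 ^ k * ?p (?x k ^ 16)"
  proof (induction k)
    case 0
    then show ?case using x by simp
  next
    case (Suc k)
    have "x * 1 \<le> x * 12 ^ k" using x by (intro mult_left_mono) auto
    then have xk: "x \<le> ?x k" using growth[of k] by simp
    have x4: "x ^ 4 \<le> ?x k ^ 4" using xk x by (intro power_mono) auto
    have "?p (?x k ^ 16) \<le> 12 / ?x k + 6 * ?p (?x k ^ 20)"
      by (rule near_singular_prob_power_step[OF _ order_trans[OF x(2) x4]]) (use x xk in auto)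
    \<comment> \<open>The exponents match because \<open>20 = 16 * 5 / 4\<close>.\<close>
    also have "?x k ^ 20 = ?x (Suc k) ^ 16" using x by (simp add: powr_power)
    also have "12 / ?x k \<le> 12 / (x * 12 ^ k)"
      using growth[of k] x by (intro divide_left_mono) auto
    finally have "6 ^ k * ?p (?x k ^ 16) \<le> 6 ^ k * (12 / (x * 12 ^ k) + 6 * ?p (?x (Suc k) ^ 16))"
      by (intro mult_left_mono) auto
    also have "\<dots> = 12 / x * (1 / 2) ^ k + 6 ^ Suc k * ?p (?x (Suc k) ^ 16)"
      using x power_mult_distrib[of "6::real" 2 k] by (simp add: field_simps)
    finally have "6 ^ k * ?p (?x k ^ 16) \<le> 12 / x * (1 / 2) ^ k + 6 ^ Suc k * ?p (?x (Suc k) ^ 16)" .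
    moreover have "24 / x * (1 - (1 / 2) ^ k) + 12 / x * (1 / 2) ^ k = 24 / x * (1 - (1 / 2) ^ Suc k)"
      using x by (simp add: field_simps)
    ultimately show ?case using Suc.IH by linarith
  qed
  moreover have "24 / x * (1 - (1 / 2) ^ k) \<le> 24 / x * 1"
    using x by (intro mult_left_mono) auto
  ultimately show ?thesis by simp
qed

end

subsection \<open>Shifts of the diagonal matrix\<close>

lemma norm_det_le:
  fixes A :: "complex mat"
  assumes A: "A \<in> carrier_mat k k" and E: "\<And>i j. i < k \<Longrightarrow> j < k \<Longrightarrow> cmod (A $$ (i, j)) \<le> E"
  shows "cmod (det A) \<le> fact k * E ^ k"
proof -
  have "cmod (det A) \<le> (\<Sum>p\<in>{p. p permutes {0..<k}}. E ^ k)"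
    unfolding det_def'[OF A]
  proof (intro sum_norm_le)
    fix p assume "p \<in> {p. p permutes {0..<k}}"
    then have p: "\<And>i. i < k \<Longrightarrow> p i < k" using permutes_in_image by fastforce
    have "cmod (signof p * (\<Prod>i = 0..<k. A $$ (i, p i))) = (\<Prod>i = 0..<k. cmod (A $$ (i, p i)))"
      by (simp add: norm_mult prod_norm[symmetric] sign_def)
    also have "\<dots> \<le> (\<Prod>i = 0..<k. E)" using p E by (intro prod_mono) auto
    finally show "cmod (signof p * (\<Prod>i = 0..<k. A $$ (i, p i))) \<le> E ^ k" by simp
  qed
  then show ?thesis by (simp add: card_permutations)
qed

lemma norm_adj_mat_le:
  fixes A :: "complex mat"
  assumes A: "A \<in> carrier_mat n n" and E: "\<And>i j. i < n \<Longrightarrow> j < n \<Longrightarrow> cmod (A $$ (i, j)) \<le> E"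
    and ij: "i < n" "j < n"
  shows "cmod (adj_mat A $$ (i, j)) \<le> fact (n - 1) * E ^ (n - 1)"
proof -
  have "cmod (adj_mat A $$ (i, j)) = cmod (det (mat_delete A j i))"
    using A ij by (simp add: adj_mat_def cofactor_def norm_mult norm_power)
  also have "\<dots> \<le> fact (n - 1) * E ^ (n - 1)"
  proof (rule norm_det_le)
    show "mat_delete A j i \<in> carrier_mat (n - 1) (n - 1)" using A by (rule mat_delete_carrier)
    fix a b assume ab: "a < n - 1" "b < n - 1"
    then have "mat_delete A j i $$ (a, b) = A $$ (if a < j then a else Suc a, if b < i then b else Suc b)"
      using A by (auto simp: mat_delete_def)
    also have "cmod \<dots> \<le> E" using ab by (intro E) auto
    finally show "cmod (mat_delete A j i $$ (a, b)) \<le> E" .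
  qed
  finally show ?thesis .
qed

lemma card_near_grid_point_le:
  fixes z :: complex and r :: real
  assumes "0 < r"
  shows "card {j \<in> {1..N::nat}. cmod (of_real (r * real j) - z) < r / 2} \<le> 1"
proof -
  have "{j \<in> {1..N}. cmod (of_real (r * real j) - z) < r / 2}
      = {j \<in> {1..N}. cmod (of_nat j * of_real r + (- z)) < cmod (of_real r) / 2}"
    using assms by (auto simp: mult.commute)
  then show ?thesis using card_linear_small_le[of "of_real r" N "- z"] assms by simp
qed

lemma prod_list_norm_ge:
  fixes as :: "complex list"
  assumes "0 \<le> r" "\<And>a. a \<in> set as \<Longrightarrow> r \<le> cmod (k - a)"
  shows "r ^ length as \<le> cmod (poly (\<Prod>a\<leftarrow>as. [:- a, 1:]) k)"
  using assms(2)
proof (induction as)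
  case (Cons a as)
  have "r * r ^ length as \<le> cmod (k - a) * cmod (poly (\<Prod>a\<leftarrow>as. [:- a, 1:]) k)"
    using Cons assms(1) by (intro mult_mono) auto
  moreover have "poly (\<Prod>a\<leftarrow>a # as. [:- a, 1:]) k = (k - a) * poly (\<Prod>a\<leftarrow>as. [:- a, 1:]) k"
    by (simp add: algebra_simps)
  ultimately show ?case by (simp add: norm_mult)
qed simp

text \<open>This exhibits the determinant as a monic polynomial of degree \<open>n\<close> in the
  shift, so it factors over the complex numbers and is small only near its roots.\<close>

lemma perturbed_shift_det:
  assumes U: "U \<in> carrier_mat n n"
  shows "det (perturbed n (\<lambda>i. d i + c) U) = poly (char_poly (- perturbed n d U)) c"
proof -
  have "- perturbed n d U \<in> carrier_mat n n" using U by simp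
  moreover have "- char_matrix (- perturbed n d U) c = perturbed n (\<lambda>i. d i + c) U"
    using U by (intro eq_matI) (auto simp: char_matrix_def perturbed_entry perturbed_def mat_diag_def)
  ultimately show ?thesis by (simp add: char_poly_matrix)
qed

text \<open>The shifts are spaced by \<open>r\<close>, so each of the at most \<open>n\<close> roots
  spoils at most one of them. At every other shift the determinant is at least
  \<open>(r / 2)^n\<close>, too large compared with the crude bound on the adjugate for an entry of
  the inverse to reach \<open>X\<close>.\<close>

lemma card_near_singular_shifts_le:
  assumes U: "U \<in> orthogonal_group n" and n: "0 < n" and r: "0 < r"
    and d: "\<And>i. i < n \<Longrightarrow> cmod (d i) \<le> K" and K: "1 \<le> K" and rN: "r * real N \<le> 1"
    and X: "fact n * (4 * K) ^ n < X * (r / 2) ^ n"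
  shows "card {j \<in> {1..N}. near_singular n (\<lambda>i. d i + of_real (r * real j)) X U} \<le> n"
proof -
  let ?P = "perturbed n d U"
  have Uc: "U \<in> carrier_mat n n" using U by (simp add: orthogonal_group_def)
  then have "- ?P \<in> carrier_mat n n" by simp
  from char_poly_factorized[OF this] obtain as where
    as: "char_poly (- ?P) = (\<Prod>a\<leftarrow>as. [:- a, 1:])" "length as = n" by blast
  have "{j \<in> {1..N}. near_singular n (\<lambda>i. d i + of_real (r * real j)) X U}
      \<subseteq> (\<Union>a\<in>set as. {j \<in> {1..N}. cmod (of_real (r * real j) - a) < r / 2})"
  proof safe
    fix j assume j: "j \<in> {1..N}" and ns: "near_singular n (\<lambda>i. d i + of_real (r * real j)) X U"
    let ?c = "complex_of_real (r * real j)"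
    let ?A = "perturbed n (\<lambda>i. d i + ?c) U"
    show "j \<in> (\<Union>a\<in>set as. {j \<in> {1..N}. cmod (of_real (r * real j) - a) < r / 2})"
    proof (rule ccontr)
      assume "\<not> ?thesis"
      then have far: "\<And>a. a \<in> set as \<Longrightarrow> r / 2 \<le> cmod (?c - a)" using j by force
      have det: "(r / 2) ^ n \<le> cmod (det ?A)"
        using prod_list_norm_ge[of "r / 2" as ?c] far r as perturbed_shift_det[OF Uc, of d ?c] by simp
      moreover have "0 < (r / 2) ^ n" using r by simp
      ultimately have "det ?A \<noteq> 0" by (metis norm_zero not_le)
      then obtain i k where ik: "i < n" "k < n" "X * cmod (det ?A) \<le> cmod (adj_mat ?A $$ (i, k))"
        using ns by (auto simp: near_singular_def)
      have "r * real j \<le> r * real N" using j r by (intro mult_left_mono) auto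
      then have "r * real j \<le> 1" using rN by linarith
      then have c1: "cmod ?c \<le> 1" unfolding norm_of_real using r by simp
      have "cmod (d i + ?c) \<le> 2 * K" if "i < n" for i
        using norm_triangle_ineq[of "d i" ?c] d[OF that] c1 K by linarith
      then have "cmod (?A $$ (i, j)) \<le> 4 * K" if "i < n" "j < n" for i j
        using perturbed_entry_le[OF U that, of "\<lambda>i. d i + ?c" "2 * K"] K by simp
      then have "cmod (adj_mat ?A $$ (i, k)) \<le> fact (n - 1) * (4 * K) ^ (n - 1)"
        using ik Uc by (intro norm_adj_mat_le) auto
      also have "\<dots> \<le> fact n * (4 * K) ^ n"
        using K by (intro mult_mono fact_mono power_increasing) auto
      also have "\<dots> < X * (r / 2) ^ n" by (rule X)
      also have "\<dots> \<le> X * cmod (det ?A)"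
      proof (rule mult_left_mono[OF det])
        have "0 < X * (r / 2) ^ n" using X K by (smt (verit) fact_gt_zero mult_pos_pos zero_less_power)
        then show "0 \<le> X" using r by (simp add: zero_less_mult_iff)
      qed
      finally show False using ik by simp
    qed
  qed
  then have "card {j \<in> {1..N}. near_singular n (\<lambda>i. d i + of_real (r * real j)) X U}
      \<le> card (\<Union>a\<in>set as. {j \<in> {1..N}. cmod (of_real (r * real j) - a) < r / 2})"
    by (intro card_mono) auto
  also have "\<dots> \<le> (\<Sum>a\<in>set as. card {j \<in> {1..N}. cmod (of_real (r * real j) - a) < r / 2})"
    by (rule card_UN_le) simp
  also have "\<dots> \<le> (\<Sum>a\<in>set as. 1)"
    by (intro sum_mono card_near_grid_point_le[OF r])
  also have "\<dots> \<le> n" using card_length[of as] as(2) by simp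
  finally show ?thesis .
qed

text \<open>Averaging: for every \<open>U\<close> at most \<open>n\<close> of the \<open>N\<close>
  shifts are bad, so the probabilities over all shifts sum to at most \<open>n\<close>, and one of
  them is at most \<open>n / N\<close>.\<close>

lemma exists_shift_near_singular_prob_le:
  assumes h: "haar_orthogonal_group n \<mu>" and n: "0 < n" and r: "0 < r"
    and d: "\<And>i. i < n \<Longrightarrow> cmod (d i) \<le> K" and K: "1 \<le> K" and N: "0 < N" and rN: "r * real N \<le> 1"
    and X: "fact n * (4 * K) ^ n < X * (r / 2) ^ n"
  shows "\<exists>l. 0 < l \<and> l \<le> r * real N \<and>
    measure \<mu> {U \<in> space \<mu>. near_singular n (\<lambda>i. d i + of_real l) X U} \<le> real n / real N"
proof (rule ccontr)
  interpret prob_space \<mu> using h by (simp add: haar_orthogonal_group_def)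
  let ?P = "\<lambda>j U. near_singular n (\<lambda>i. d i + of_real (r * real j)) X U"
  assume none: "\<not> ?thesis"
  have big: "real n / real N < prob {U \<in> space \<mu>. ?P j U}" if "j \<in> {1..N}" for j
  proof -
    have "0 < r * real j" "r * real j \<le> r * real N" using that r by auto
    then show ?thesis using none by (metis not_le)
  qed
  have "real n = (\<Sum>j\<in>{1..N}. real n / real N)" using N by simp
  also have "\<dots> < (\<Sum>j\<in>{1..N}. prob {U \<in> space \<mu>. ?P j U})"
    using big N by (intro sum_strict_mono) auto
  also have "\<dots> = expectation (\<lambda>U. real (card {j \<in> {1..N}. ?P j U}))"
    by (rule sum_prob_eq_expectation_card) (auto intro: near_singular_measurable[OF h])
  also have "\<dots> \<le> expectation (\<lambda>U. real n)"
  proof (rule integral_mono)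
    show "integrable \<mu> (\<lambda>U. real (card {j \<in> {1..N}. ?P j U}))"
      by (rule sum_prob_eq_expectation_card) (auto intro: near_singular_measurable[OF h])
    fix U assume "U \<in> space \<mu>"
    then show "real (card {j \<in> {1..N}. ?P j U}) \<le> real n"
      using card_near_singular_shifts_le[where d = d and K = K, OF _ n r d K rN X] haar_space[OF h] by simp
  qed simp
  also have "\<dots> = real n" by (simp add: prob_space)
  finally show False by simp
qed

lemma eventually_double_exponential_gt:
  fixes x a b :: real
  assumes "1 < x" "0 < a" "0 < b"
  shows "\<exists>k. a * b ^ k < x powr ((5 / 4) ^ k)"
proof -
  define c where "c = ln x"
  have "0 < c" using assms by (simp add: c_def)
  then have "eventually (\<lambda>k::nat. ln a + real k * ln b < (5 / 4) ^ k * c) at_top"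
    by real_asymp
  then obtain k :: nat where "ln a + real k * ln b < (5 / 4) ^ k * c"
    by (auto simp: eventually_at_top_linorder)
  then have "ln (a * b ^ k) < ln (x powr ((5 / 4) ^ k))"
    using assms by (simp add: ln_mult ln_realpow ln_powr c_def)
  moreover have "0 < a * b ^ k" "0 < x powr ((5 / 4) ^ k)" using assms by auto
  ultimately have "a * b ^ k < x powr ((5 / 4) ^ k)" by (simp only: ln_less_cancel_iff)
  then show ?thesis by blast
qed

text \<open>The shift depends on \<open>k\<close>, so a rate of decay is needed here: the number \<open>N\<close> of candidate shifts has
  to absorb \<open>6\<^sup>k\<close>, which only costs a factor exponential in \<open>k\<close> against the doubly exponential size.\<close>

lemma exists_shift_scaled_prob_le:
  fixes x \<epsilon> t :: real
  assumes h: "haar_orthogonal_group n \<mu>" and n: "0 < n" and t: "0 < t" "t \<le> 1"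
    and d: "\<And>i. i < n \<Longrightarrow> cmod (d i) \<le> K" and K: "1 \<le> K" and x: "1 < x" and \<epsilon>: "0 < \<epsilon>" "\<epsilon> \<le> 1"
  shows "\<exists>k l. 0 < l \<and> l \<le> t \<and>
    6 ^ k * measure \<mu> {U \<in> space \<mu>. near_singular n (\<lambda>i. d i + of_real l) ((x powr ((5 / 4) ^ k)) ^ 16) U} \<le> \<epsilon>"
proof -
  define W where "W = fact n * (4 * K) ^ n"
  have W: "0 < W" using K by (simp add: W_def)
  obtain k where k: "W * (4 * real n / (\<epsilon> * t)) ^ n * (6 ^ n) ^ k < x powr ((5 / 4) ^ k)"
    using eventually_double_exponential_gt[OF x, of "W * (4 * real n / (\<epsilon> * t)) ^ n" "6 ^ n"] W n \<epsilon> t by auto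
  \<comment> \<open>With at least \<open>y\<close> candidates, \<open>6^k * n / N\<close> is at most
    \<open>\<epsilon>\<close>. Rounding up at most doubles \<open>y\<close>, which explains the
    factor 4 in the choice of \<open>k\<close>.\<close>
  define y where "y = real n * 6 ^ k / \<epsilon>"
  define N where "N = nat \<lceil>y\<rceil>"
  have "1 * 1 \<le> real n * 6 ^ k" using n by (intro mult_mono) auto
  then have big: "1 \<le> y" using \<epsilon> by (simp add: y_def field_simps)
  have N1: "y \<le> real N" unfolding N_def by linarith
  have "real N = of_int \<lceil>y\<rceil>" unfolding N_def using big by (intro of_nat_nat) linarith
  then have N2: "real N \<le> 2 * y" using big by linarith
  have Npos: "0 < N" using N1 big by (cases N) auto
  define X where "X = (x powr ((5 / 4) ^ k)) ^ 16"
  have "1 \<le> x powr ((5 / 4) ^ k)" using x by (simp add: ge_one_powr_ge_zero)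
  then have X1: "x powr ((5 / 4) ^ k) \<le> X" unfolding X_def using power_increasing[of 1 16 "x powr ((5 / 4) ^ k)"] by simp
  have "W * (2 * real N / t) ^ n \<le> W * (2 * (2 * y) / t) ^ n"
    using N2 t W by (intro mult_left_mono power_mono divide_right_mono) auto
  also have "\<dots> = W * (4 * real n / (\<epsilon> * t)) ^ n * (6 ^ n) ^ k"
    by (simp add: y_def power_divide power_mult_distrib mult.commute flip: power_mult)
  also have "\<dots> < X" using k X1 by linarith
  finally have "W < X * (t / real N / 2) ^ n"
    using t Npos by (simp add: field_simps)
  then have "\<exists>l. 0 < l \<and> l \<le> t / real N * real N \<and>
      measure \<mu> {U \<in> space \<mu>. near_singular n (\<lambda>i. d i + of_real l) X U} \<le> real n / real N"
    using t Npos unfolding W_def by (intro exists_shift_near_singular_prob_le[where d = d and K = K, OF h n _ d K]) auto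
  then obtain l where l: "0 < l" "l \<le> t" "measure \<mu> {U \<in> space \<mu>. near_singular n (\<lambda>i. d i + of_real l) X U} \<le> real n / real N"
    using Npos by auto
  have "6 ^ k * measure \<mu> {U \<in> space \<mu>. near_singular n (\<lambda>i. d i + of_real l) X U} \<le> 6 ^ k * (real n / real N)"
    using l by (intro mult_left_mono) auto
  also have "\<dots> \<le> \<epsilon>" using N1 Npos \<epsilon> by (simp add: y_def field_simps)
  finally show ?thesis using l unfolding X_def by blast
qed

subsection \<open>Singular values and conclusion\<close>

lemma mat_adjoint_carrier:
  "A \<in> carrier_mat n n \<Longrightarrow> mat_adjoint A \<in> carrier_mat n n"
  by (auto simp: mat_adjoint_def)

lemma mat_adjoint_index:
  fixes A :: "complex mat"
  assumes "A \<in> carrier_mat n n" "i < n" "j < n"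
  shows "mat_adjoint A $$ (i, j) = cnj (A $$ (j, i))"
  using assms by (simp add: mat_adjoint_def mat_of_rows_def)

text \<open>Pair the eigenvalue equation with \<open>v\<close> and move the adjoint to the other
  side. In particular every eigenvalue of the Gram matrix is real and nonnegative.\<close>

lemma gram_eigenvector:
  fixes A :: "complex mat"
  assumes A: "A \<in> carrier_mat n n" and ev: "eigenvector (mat_adjoint A * A) v e"
  shows "e * of_real (\<Sum>i<n. (cmod (v $ i))\<^sup>2) = of_real (\<Sum>i<n. (cmod ((A *\<^sub>v v) $ i))\<^sup>2)"
    and "v \<in> carrier_vec n" "0 < (\<Sum>i<n. (cmod (v $ i))\<^sup>2)"
proof -
  have A': "mat_adjoint A \<in> carrier_mat n n" by (rule mat_adjoint_carrier[OF A])
  then have "dim_row (mat_adjoint A * A) = n" by simp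
  with ev have v: "v \<in> carrier_vec n" "v \<noteq> 0\<^sub>v n" "mat_adjoint A * A *\<^sub>v v = e \<cdot>\<^sub>v v"
    by (auto simp: eigenvector_def)
  show "v \<in> carrier_vec n" by (rule v(1))
  have "\<exists>i<n. v $ i \<noteq> 0" using v(1,2) by (auto intro!: eq_vecI)
  then show "0 < (\<Sum>i<n. (cmod (v $ i))\<^sup>2)"
    by (auto intro!: sum_pos2)
  define y where "y = A *\<^sub>v v"
  have y: "y \<in> carrier_vec n" using A v by (simp add: y_def)
  have "e * of_real (\<Sum>i<n. (cmod (v $ i))\<^sup>2) = (\<Sum>i<n. cnj (v $ i) * (e \<cdot>\<^sub>v v) $ i)"
    using v(1) by (simp add: sum_distrib_left complex_norm_square algebra_simps del: of_real_power)
  also have "\<dots> = (\<Sum>i<n. cnj (v $ i) * (mat_adjoint A *\<^sub>v y) $ i)"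
    unfolding v(3)[symmetric] y_def using assoc_mult_mat_vec[OF A' A v(1)] by simp
  also have "\<dots> = (\<Sum>i<n. \<Sum>k<n. cnj (v $ i) * cnj (A $$ (k, i)) * y $ k)"
    by (intro sum.cong refl)
      (simp add: mult_mat_vec_index_sum[OF A' y] mat_adjoint_index[OF A] sum_distrib_left mult.assoc del: index_mult_mat_vec)
  also have "\<dots> = (\<Sum>k<n. cnj (\<Sum>i<n. A $$ (k, i) * v $ i) * y $ k)"
    by (subst sum.swap) (simp add: sum_distrib_left sum_distrib_right mult_ac)
  also have "\<dots> = (\<Sum>k<n. cnj (y $ k) * y $ k)"
    unfolding y_def by (intro sum.cong refl)
      (simp add: mult_mat_vec_index_sum[OF A v(1)] del: index_mult_mat_vec)
  also have "\<dots> = of_real (\<Sum>i<n. (cmod (y $ i))\<^sup>2)"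
    by (simp add: complex_norm_square mult.commute del: of_real_power)
  finally show "e * of_real (\<Sum>i<n. (cmod (v $ i))\<^sup>2) = of_real (\<Sum>i<n. (cmod ((A *\<^sub>v v) $ i))\<^sup>2)"
    by (simp add: y_def)
qed

lemma s_min_le_imp_near_kernel:
  fixes A :: "complex mat"
  assumes A: "A \<in> carrier_mat n n" and n: "0 < n" and t: "s_min A \<le> t"
  obtains v where "v \<in> carrier_vec n" "0 < (\<Sum>i<n. (cmod (v $ i))\<^sup>2)"
    "(\<Sum>i<n. (cmod ((A *\<^sub>v v) $ i))\<^sup>2) \<le> t\<^sup>2 * (\<Sum>i<n. (cmod (v $ i))\<^sup>2)"
proof -
  let ?G = "mat_adjoint A * A"
  have G: "?G \<in> carrier_mat n n" by (rule mult_carrier_mat[OF mat_adjoint_carrier[OF A] A])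
  have "finite (singular_values A)"
  proof (rule finite_subset)
    show "singular_values A \<subseteq> (\<lambda>e. sqrt (Re e)) ` spectrum ?G"
    proof
      fix s assume s: "s \<in> singular_values A"
      then have "s = sqrt (Re (complex_of_real (s\<^sup>2)))" by (simp add: singular_values_def)
      then show "s \<in> (\<lambda>e. sqrt (Re e)) ` spectrum ?G"
        using s by (intro image_eqI[of _ _ "complex_of_real (s\<^sup>2)"]) (auto simp: singular_values_def spectrum_def)
    qed
    show "finite ((\<lambda>e. sqrt (Re e)) ` spectrum ?G)" using card_finite_spectrum(1)[OF G] by simp
  qed
  \<comment> \<open>\<open>Min\<close> is meaningful only on a finite nonempty set. A complex matrix
    of positive size has an eigenvalue, and for the Gram matrix it is a quotient of squared lengths,
    hence the square of a singular value.\<close>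
  moreover have "singular_values A \<noteq> {}"
  proof -
    obtain e where "eigenvalue ?G e" using spectrum_non_empty[OF G n] by (auto simp: spectrum_def)
    then obtain v where "eigenvector ?G v e" by (auto simp: eigenvalue_def)
    note g = gram_eigenvector[OF A this]
    define s where "s = (\<Sum>i<n. (cmod ((A *\<^sub>v v) $ i))\<^sup>2) / (\<Sum>i<n. (cmod (v $ i))\<^sup>2)"
    have "e = of_real s" using g(1,3) unfolding s_def of_real_divide
      by (metis eq_divide_imp less_irrefl of_real_eq_0_iff)
    moreover have "0 \<le> s" unfolding s_def by (intro divide_nonneg_nonneg sum_nonneg) auto
    moreover have "(sqrt s)\<^sup>2 = s" using \<open>0 \<le> s\<close> by simp
    ultimately have "0 \<le> sqrt s" "eigenvalue ?G (of_real ((sqrt s)\<^sup>2))"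
      using \<open>eigenvalue ?G e\<close> by (simp_all only: real_sqrt_ge_0_iff)
    then have "sqrt s \<in> singular_values A" unfolding singular_values_def by blast
    then show ?thesis by blast
  qed
  ultimately have "s_min A \<in> singular_values A" unfolding s_min_def by (rule Min_in)
  then have s0: "0 \<le> s_min A" and "eigenvalue ?G (of_real ((s_min A)\<^sup>2))" by (auto simp: singular_values_def)
  then obtain v where "eigenvector ?G v (of_real ((s_min A)\<^sup>2))" by (auto simp: eigenvalue_def)
  note g = gram_eigenvector[OF A this]
  have "(\<Sum>i<n. (cmod ((A *\<^sub>v v) $ i))\<^sup>2) = (s_min A)\<^sup>2 * (\<Sum>i<n. (cmod (v $ i))\<^sup>2)"
    using g(1) unfolding of_real_mult[symmetric] of_real_eq_iff by simp
  also have "\<dots> \<le> t\<^sup>2 * (\<Sum>i<n. (cmod (v $ i))\<^sup>2)"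
    using t s0 g(3) by (intro mult_right_mono power_mono) auto
  finally show thesis using g(2,3) that by blast
qed

text \<open>Let \<open>a\<close> be the sup norm of a near-kernel vector \<open>v\<close>. Since
  \<open>l\<close> is at most \<open>t\<close>, the shifted matrix still maps \<open>v\<close> to
  entries of size at most \<open>2 t n a\<close>. If all entries of its inverse were below the
  threshold, recovering \<open>v\<close> would give entries of size at most
  \<open>a / 2\<close>.\<close>

lemma s_min_le_imp_near_singular:
  assumes U: "U \<in> carrier_mat n n" and n: "0 < n" and l: "0 < l" "l \<le> t"
    and s: "s_min (perturbed n d U) \<le> t"
  shows "near_singular n (\<lambda>i. d i + of_real l) (1 / (4 * (real n)\<^sup>2 * t)) U"
proof (rule ccontr)
  let ?A = "perturbed n d U" and ?L = "perturbed n (\<lambda>i. d i + of_real l) U"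
  let ?T = "1 / (4 * (real n)\<^sup>2 * t)"
  have A: "?A \<in> carrier_mat n n" and L: "?L \<in> carrier_mat n n" using U by auto
  have t: "0 < t" using l by linarith
  obtain v where v: "v \<in> carrier_vec n" "0 < (\<Sum>i<n. (cmod (v $ i))\<^sup>2)"
    "(\<Sum>i<n. (cmod ((?A *\<^sub>v v) $ i))\<^sup>2) \<le> t\<^sup>2 * (\<Sum>i<n. (cmod (v $ i))\<^sup>2)"
    using s_min_le_imp_near_kernel[OF A n s] by blast
  define a where "a = Max ((\<lambda>i. cmod (v $ i)) ` {..<n})"
  have a_ge: "cmod (v $ i) \<le> a" if "i < n" for i
    using that unfolding a_def by (intro Max_ge) auto
  have "a \<in> (\<lambda>i. cmod (v $ i)) ` {..<n}" unfolding a_def using n by (intro Max_in) auto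
  then obtain p where p: "p < n" "a = cmod (v $ p)" by auto
  have apos: "0 < a"
  proof (rule ccontr)
    assume "\<not> 0 < a"
    then have "cmod (v $ i) = 0" if "i < n" for i using a_ge[OF that] by (smt (verit) norm_ge_zero)
    then show False using v(2) by simp
  qed
  have n1: "1 \<le> real n" using n by simp
  have Av: "cmod ((?A *\<^sub>v v) $ i) \<le> t * real n * a" if i: "i < n" for i
  proof -
    have "(cmod ((?A *\<^sub>v v) $ i))\<^sup>2 \<le> (\<Sum>i<n. (cmod ((?A *\<^sub>v v) $ i))\<^sup>2)"
      using i by (intro member_le_sum) auto
    also have "\<dots> \<le> t\<^sup>2 * (\<Sum>i<n. (cmod (v $ i))\<^sup>2)" by (rule v(3))
    also have "\<dots> \<le> t\<^sup>2 * (\<Sum>i<n. a\<^sup>2)"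
      using a_ge by (intro mult_left_mono sum_mono power_mono) auto
    also have "\<dots> \<le> t\<^sup>2 * ((real n)\<^sup>2 * a\<^sup>2)"
      using n1 power_increasing[of 1 2 "real n"] by (intro mult_left_mono) (auto intro!: mult_right_mono)
    also have "\<dots> = (t * real n * a)\<^sup>2" by (simp add: power_mult_distrib)
    finally show ?thesis by (rule power2_le_imp_le) (use t apos in simp)
  qed
  have Lv: "cmod ((?L *\<^sub>v v) $ i) \<le> 2 * t * real n * a" if i: "i < n" for i
  proof -
    have "(?L *\<^sub>v v) $ i = (\<Sum>j<n. ?A $$ (i, j) * v $ j + (if j = i then of_real l * v $ i else 0))"
      unfolding mult_mat_vec_index_sum[OF L v(1) i]
      using i U by (intro sum.cong) (auto simp: perturbed_entry algebra_simps)
    also have "\<dots> = (?A *\<^sub>v v) $ i + of_real l * v $ i"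
      unfolding mult_mat_vec_index_sum[OF A v(1) i] using i by (simp add: sum.distrib)
    also have "cmod \<dots> \<le> t * real n * a + l * a"
      using Av[OF i] a_ge[OF i] l by (intro norm_triangle_mono) (auto simp: norm_mult)
    also have "l * a \<le> t * real n * a"
      using l apos n1 mult_mono[of l t 1 "real n"] by (intro mult_right_mono) auto
    finally show ?thesis by (simp add: mult_ac)
  qed
  assume ns: "\<not> near_singular n (\<lambda>i. d i + of_real l) ?T U"
  then have det: "det ?L \<noteq> 0" by (auto simp: near_singular_def)
  note B = scaled_adj[OF L det]
  have B_le: "cmod (scaled_adj ?L $$ (i, j)) \<le> ?T" if "i < n" "j < n" for i j
    using ns that near_singular_iff[OF U det] by force
  have Lv_c: "?L *\<^sub>v v \<in> carrier_vec n" using mult_mat_vec_carrier[OF L v(1)] .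
  have "v $ p = (scaled_adj ?L *\<^sub>v (?L *\<^sub>v v)) $ p"
    using assoc_mult_mat_vec[OF B(1) L v(1)] v(1) by (simp add: B(3))
  also have "\<dots> = (\<Sum>j<n. scaled_adj ?L $$ (p, j) * (?L *\<^sub>v v) $ j)"
    by (rule mult_mat_vec_index_sum[OF B(1) Lv_c p(1)])
  also have "cmod \<dots> \<le> (\<Sum>j<n. ?T * (2 * t * real n * a))"
  proof (rule sum_norm_le)
    fix j assume "j \<in> {..<n}"
    then show "cmod (scaled_adj ?L $$ (p, j) * (?L *\<^sub>v v) $ j) \<le> ?T * (2 * t * real n * a)"
      unfolding norm_mult using B_le[OF p(1)] Lv t by (intro mult_mono) auto
  qed
  also have "\<dots> = a / 2" using t n1 by (simp add: field_simps power2_eq_square)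
  finally show False using p apos by simp
qed

section \<open>Choice of parameters and conclusion\<close>

theorem theorem1p3:
  shows "\<exists>C c :: real. C > 0 \<and> c > 0 \<and>
    (\<forall>(n :: nat) (d :: nat \<Rightarrow> complex) (K :: real) (\<delta> :: real) (\<mu> :: real mat measure).
       n \<ge> 2 \<longrightarrow>
       (MAX i\<in>{..<n}. cmod (d i)) \<le> K \<longrightarrow>
       (MAX (i, j)\<in>{..<n} \<times> {..<n}. cmod ((d i)\<^sup>2 - (d j)\<^sup>2)) \<ge> \<delta> \<longrightarrow>
       K \<ge> 1 \<longrightarrow> 0 < \<delta> \<longrightarrow> \<delta> < 1 \<longrightarrow>
       haar_orthogonal_group n \<mu> \<longrightarrow>
       (\<forall>t > 0. measure \<mu> {U \<in> space \<mu>. s_min (mat_diag n d + map_mat complex_of_real U) \<le> t}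
                  \<le> t powr c * (K * real n / \<delta>) powr C))"
proof (rule exI[of _ 25], rule exI[of _ "1 / 16"], intro conjI allI impI)
  fix n :: nat and d :: "nat \<Rightarrow> complex" and K \<delta> t :: real and \<mu> :: "real mat measure"
  assume n2: "2 \<le> n" and dK: "(MAX i\<in>{..<n}. cmod (d i)) \<le> K"
    and dd: "\<delta> \<le> (MAX (i, j)\<in>{..<n} \<times> {..<n}. cmod ((d i)\<^sup>2 - (d j)\<^sup>2))"
    and K: "1 \<le> K" and \<delta>: "0 < \<delta>" "\<delta> < 1" and h: "haar_orthogonal_group n \<mu>" and t: "0 < t"
  interpret prob_space \<mu> using h by (simp add: haar_orthogonal_group_def)
  let ?E = "{U \<in> space \<mu>. s_min (mat_diag n d + map_mat complex_of_real U) \<le> t}"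
  define Z where "Z = K * real n / \<delta>"
  define y where "y = t powr (1 / 16)"
  have n: "0 < n" using n2 by simp
  have ypos: "0 < y" using t by (simp add: y_def)
  have ty: "t = y ^ 16" using t by (simp add: y_def powr_power)
  have nZ: "real n \<le> Z"
    unfolding Z_def using K \<delta> n mult_mono[of 1 K \<delta> 1] by (simp add: field_simps)
  have Z2: "2 \<le> Z" using nZ n2 by linarith
  have KZ: "K / \<delta> \<le> Z"
    unfolding Z_def using K \<delta> n by (simp add: divide_right_mono)
  have "measure \<mu> ?E \<le> y * Z ^ 25"
  \<comment> \<open>If the claimed bound is at least 1 it is trivial; otherwise \<open>t\<close> is
    smaller than any needed power of \<open>1 / Z\<close>.\<close>
  proof (cases "1 \<le> y * Z ^ 25")
    case True
    then show ?thesis using prob_le_1 order_trans by blast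
  next
    case False
    then have small: "y * Z ^ 25 < 1" by simp
    have d_le: "cmod (d i) \<le> K" if "i < n" for i
      by (rule order_trans[OF Max_ge dK]) (use that in auto)
    \<comment> \<open>Two squares at distance at least \<open>\<delta>\<close> cannot both lie
      within less than \<open>\<delta> / 2\<close> of 1.\<close>
    obtain i0 where i0: "i0 < n" "\<delta> / 2 \<le> cmod (1 - (d i0)\<^sup>2)"
    proof -
      have "(MAX (i, j)\<in>{..<n} \<times> {..<n}. cmod ((d i)\<^sup>2 - (d j)\<^sup>2))
          \<in> (\<lambda>(i, j). cmod ((d i)\<^sup>2 - (d j)\<^sup>2)) ` ({..<n} \<times> {..<n})"
        using n by (intro Max_in) auto
      then obtain i j where ij: "i < n" "j < n" "\<delta> \<le> cmod ((d i)\<^sup>2 - (d j)\<^sup>2)" using dd by auto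
      have "cmod ((d i)\<^sup>2 - (d j)\<^sup>2) = cmod ((1 - (d j)\<^sup>2) - (1 - (d i)\<^sup>2))" by simp
      also have "\<dots> \<le> cmod (1 - (d j)\<^sup>2) + cmod (1 - (d i)\<^sup>2)" by (rule norm_triangle_ineq4)
      finally have "\<delta> / 2 \<le> cmod (1 - (d j)\<^sup>2) \<or> \<delta> / 2 \<le> cmod (1 - (d i)\<^sup>2)" using ij(3) by linarith
      then show thesis using that ij by blast
    qed
    \<comment> \<open>This makes the sixteenth power of \<open>x = 1 / (g * y)\<close> the threshold
      \<open>1 / (4 n^2 t)\<close> coming from the smallest singular value.\<close>
    define g where "g = (4 * (real n)\<^sup>2) powr (1 / 16)"
    have g16: "g ^ 16 = 4 * (real n)\<^sup>2" using n by (simp add: g_def powr_power)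
    have gpos: "0 < g" using n by (simp add: g_def)
    have "1 \<le> real n" using n by simp
    then have n4: "1 \<le> 4 * (real n)\<^sup>2" using one_le_power[of "real n" 2] by linarith
    then have "g \<le> (4 * (real n)\<^sup>2) powr 1" unfolding g_def by (intro powr_mono) auto
    then have gn: "g \<le> 4 * (real n)\<^sup>2" using n by simp
    have "4 * (real n)\<^sup>2 \<le> Z\<^sup>2 * Z\<^sup>2"
      using power_mono[OF Z2, of 2] power_mono[OF nZ, of 2] by (intro mult_mono) auto
    then have gZ: "g \<le> Z ^ 4" using gn by (simp add: power2_eq_square power_def numeral_eq_Suc)
    have yZ: "y \<le> 1 / Z ^ 25" using small Z2 by (simp add: field_simps)
    define x where "x = 1 / (g * y)"
    have x16: "x ^ 16 = 1 / (4 * (real n)\<^sup>2 * t)" unfolding x_def ty using g16 by (simp add: power_divide power_mult_distrib)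
    have x21: "Z ^ 21 \<le> x"
    proof -
      have "g * y \<le> Z ^ 4 * (1 / Z ^ 25)" using gZ yZ gpos ypos by (intro mult_mono) auto
      also have "\<dots> = 1 / Z ^ 21" using Z2 by (simp add: field_simps flip: power_add)
      finally show ?thesis unfolding x_def using gpos ypos Z2 by (simp add: field_simps)
    qed
    have "(2::real) ^ 15 \<le> Z ^ 15" using Z2 by (intro power_mono) auto
    also have "\<dots> \<le> Z ^ 21" using Z2 by (intro power_increasing) auto
    finally have x15: "2 ^ 15 \<le> x" using x21 by linarith
    have "t \<le> (1 / Z ^ 25) ^ 16" unfolding ty using yZ ypos by (intro power_mono) auto
    also have "\<dots> = 1 / Z ^ 400" by (simp add: power_divide flip: power_mult)
    also have "\<dots> \<le> 1 / Z ^ 5" using Z2 by (intro divide_left_mono power_increasing) auto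
    finally have t5: "t \<le> 1 / Z ^ 5" .
    \<comment> \<open>The shift changes \<open>1 - (d i0)^2\<close> by at most \<open>3 K t\<close>,
      which must not exceed \<open>\<delta> / 4\<close>.\<close>
    have t\<delta>: "12 * K * t \<le> \<delta>"
    proof -
      have "16 * Z \<le> Z ^ 4 * Z" using power_mono[OF Z2, of 4] Z2 by (intro mult_right_mono) auto
      then have "16 * (K / \<delta>) \<le> Z ^ 5" using KZ by (simp add: power_def numeral_eq_Suc)
      then have "16 * (K / \<delta>) * t \<le> Z ^ 5 * (1 / Z ^ 5)" using t5 t Z2 by (intro mult_mono) auto
      also have "\<dots> = 1" using Z2 by simp
      finally have "16 * K * t \<le> \<delta>" using \<delta> by (simp add: field_simps)
      moreover have "0 \<le> K * t" using K t by simp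
      ultimately show ?thesis by linarith
    qed
    have "12 * 1 * t \<le> 12 * K * t" using K t by (intro mult_mono) auto
    then have t1: "t \<le> 1" using t\<delta> \<delta> by linarith
    \<comment> \<open>Taking \<open>\<epsilon> = 1 / x\<close> makes the remainder after
      \<open>k\<close> iterations comparable to the error \<open>24 / x\<close>, for a total of
      \<open>25 / x\<close>.\<close>
    have "0 < 1 / x" "1 / x \<le> 1" using x15 by auto
    then obtain k l where l: "0 < l" "l \<le> t"
      "6 ^ k * prob {U \<in> space \<mu>. near_singular n (\<lambda>i. d i + of_real l) ((x powr ((5 / 4) ^ k)) ^ 16) U} \<le> 1 / x"
      using exists_shift_scaled_prob_le[where d = d and K = K, OF h n t t1 d_le K, of x "1 / x"] x15 by auto
    let ?d = "\<lambda>i. d i + complex_of_real l"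
    have d': "cmod (?d i) \<le> 2 * K" if "i < n" for i
      using norm_triangle_ineq[of "d i" "of_real l"] d_le[OF that] l t1 K by simp
    have i0': "\<delta> / 4 \<le> cmod (1 - (?d i0)\<^sup>2)"
    proof -
      have "1 - (d i0)\<^sup>2 = (1 - (?d i0)\<^sup>2) + of_real l * (2 * d i0 + of_real l)"
        by (simp add: power2_eq_square algebra_simps)
      then have "cmod (1 - (d i0)\<^sup>2) \<le> cmod (1 - (?d i0)\<^sup>2) + cmod (of_real l * (2 * d i0 + of_real l))"
        by (metis norm_triangle_ineq)
      moreover have "cmod (of_real l * (2 * d i0 + of_real l)) \<le> t * (2 * K + K)"
      proof -
        have "cmod (2 * d i0 + of_real l) \<le> 2 * K + K"
          using d_le[OF i0(1)] l t1 K by (intro norm_triangle_mono) (auto simp: norm_mult)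
        then show ?thesis using l by (simp add: norm_mult mult_mono)
      qed
      ultimately show ?thesis using i0(2) t\<delta> by (simp add: algebra_simps)
    qed
    have x4: "2 ^ 60 * real n ^ 17 * (2 * K)\<^sup>2 / (\<delta> / 4) \<le> x ^ 4"
    proof -
      have "2 ^ 60 * real n ^ 17 * (2 * K)\<^sup>2 / (\<delta> / 4) = 2 ^ 64 * real n ^ 15 * (real n * K)\<^sup>2 / \<delta>"
        by (simp add: power_mult_distrib flip: power_add mult.assoc)
      \<comment> \<open>Since \<open>\<delta> < 1\<close>, squaring the denominator only increases
        the quotient and completes \<open>Z^2\<close>; with \<open>2 <= Z\<close> and
        \<open>n <= Z\<close> the total exponent is \<open>64 + 15 + 2 = 81\<close>, below
        \<open>84 = 4 * 21\<close>.\<close>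
      also have "\<dots> \<le> 2 ^ 64 * real n ^ 15 * (real n * K)\<^sup>2 / \<delta>\<^sup>2"
        using \<delta> K by (intro divide_left_mono) (auto simp: power2_eq_square)
      also have "\<dots> = 2 ^ 64 * real n ^ 15 * Z\<^sup>2" by (simp add: Z_def power_divide mult.commute)
      also have "\<dots> \<le> Z ^ 64 * Z ^ 15 * Z\<^sup>2"
        using Z2 nZ by (intro mult_mono power_mono) auto
      also have "\<dots> \<le> Z ^ 84" unfolding power_add[symmetric] using Z2 by (intro power_increasing) auto
      also have "\<dots> = (Z ^ 21) ^ 4" by (simp flip: power_mult)
      also have "\<dots> \<le> x ^ 4" using x21 Z2 by (intro power_mono) auto
      finally show ?thesis .
    qed
    have "?E \<subseteq> {U \<in> space \<mu>. near_singular n ?d (x ^ 16) U}"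
      unfolding x16
      using s_min_le_imp_near_singular[OF _ n l(1,2)] haar_space[OF h]
      by (auto simp: perturbed_def orthogonal_group_def)
    then have "measure \<mu> ?E \<le> prob {U \<in> space \<mu>. near_singular n ?d (x ^ 16) U}"
      by (rule finite_measure_mono) (rule near_singular_measurable[OF h])
    also have "\<dots> \<le> 24 / x + 6 ^ k * prob {U \<in> space \<mu>. near_singular n ?d ((x powr ((5 / 4) ^ k)) ^ 16) U}"
      by (rule near_singular_prob_iterate[where d = ?d and K = "2 * K", OF h n d' _ i0(1) i0' _ _ x15 x4]) (use K \<delta> in auto)
    also have "\<dots> \<le> 25 * (g * y)" using l(3) by (simp add: x_def)
    \<comment> \<open>The exponent 25 splits as \<open>21 + 4\<close>: \<open>Z^4\<close> bounds
      \<open>g\<close>, and \<open>Z^21\<close> bounds the numerical factor here as it bounded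
      \<open>x\<close> from below.\<close>
    also have "\<dots> \<le> Z ^ 21 * (Z ^ 4 * y)"
    proof (intro mult_mono)
      have "(2::real) ^ 21 \<le> Z ^ 21" using Z2 by (intro power_mono) auto
      then show "25 \<le> Z ^ 21" by simp
    qed (use gZ ypos gpos Z2 in auto)
    also have "\<dots> = y * Z ^ 25" by (simp add: power_add[symmetric] flip: mult.assoc)
    finally show ?thesis .
  qed
  also have "\<dots> = t powr (1 / 16) * (K * real n / \<delta>) powr 25"
    using Z2 by (simp add: y_def Z_def powr_numeral)
  finally show "measure \<mu> ?E \<le> t powr (1 / 16) * (K * real n / \<delta>) powr 25" .
qed auto

end
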